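(* Let $\Bbbk$ be an algebraically closed field of characteristic $0$, let $G$ be a finite group and $H=(\Bbbk G)^*$. Let $A$ be a noetherian connected graded Artin-Schelter regular $\Bbbk$-algebra that is a domain and is generated in degree one. Suppose that $A$ is a left $H$-module algebra on which $H$ acts homogeneously and inner-faithfully, and that $A^H$ is Artin-Schelter regular. Let $\mathsf{j}_{A,H}$ and $\mathsf{a}_{A,H}$ be the Jacobian and the reflection arrangement of the $H$-action on $A$. Then: (1) $\mathsf{j}_{A,H}$ is a product of elements of degree one. (2) $\mathsf{a}_{A,H}$ is a product of elements of degree one.
   Context: Let $K=H^*$ ($=\Bbbk G$) and let $G(K)$ be the group of grouplike elements of $K$ ($=G$), i.e. algebra homomorphisms $H\to\Bbbk$ under convolution, with inverse $g^{-1}=g\circ S$, $S$ the antipode of $H$ and $\epsilon$ its counit. A connected graded algebra is $A=\bigoplus_{i\ge 0}A_i$ with $A_0=\Bbbk$. It is Artin-Schelter (AS) Gorenstein if (a) $A$ has finite injective dimension $d$ on the left and on the right; (b) $\mathrm{Ext}^i_A({}_A\Bbbk,{}_AA)=\mathrm{Ext}^i_A(\Bbbk_A,A_A)=0$ for $i\ne d$; (c) $\mathrm{Ext}^d_A({}_A\Bbbk,{}_AA)\cong\mathrm{Ext}^d_A(\Bbbk_A,A_A)\cong\Bbbk(\mathfrak l)$ for some integer $\mathfrak l$. It is AS regular if moreover it has finite global dimension and finite Gelfand-Kirillov dimension. $H$ acts homogeneously if each $A_i$ is an $H$-submodule, and inner-faithfully if no nonzero Hopf ideal $I$ of $H$ satisfies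 $I\cdot A=0$. $R:=A^H=\{a\in A: h\cdot a=\epsilon(h)a\ \forall h\in H\}$. For $g\in G(K)$, $A_g=\{a\in A: h\cdot a=g(h)a\ \forall h\in H\}$. Homological determinant: let $\mathfrak m=A_{\ge1}$. Viewing $A$ as a graded left module over the smash product $A\#H$ (and computing with injective resolutions of graded $A\#H$-modules, which restrict to injective resolutions over $A$), the local cohomology $H^d_{\mathfrak m}(A)$ carries a left $H$-action, so its graded dual carries a right $H$-action. The lowest-degree component of $H^d_{\mathfrak m}(A)^*$ is one-dimensional, spanned by some $\mathfrak e$, and $\mathfrak e\cdot h=\eta(h)\mathfrak e$ for an algebra map $\eta:H\to\Bbbk$. Then $\mathrm{hdet}:=\eta\circ S$, an element of $G(K)$. Under the stated hypotheses $A_{\mathrm{hdet}^{-1}}$ and $A_{\mathrm{hdet}}$ are free $R$-modules of rank one on both sides. The Jacobian $\mathsf{j}_{A,H}$ is the (unique up to nonzero scalar) element with $A_{\mathrm{hdet}^{-1}}=\mathsf{j}_{A,H}R=R\,\mathsf{j}_{A,H}$, and the reflection arrangement $\mathsf{a}_{A,H}$ is the (unique up to nonzero scalar) element with $A_{\mathrm{hdet}}=\mathsf{a}_{A,H}R=R\,\mathsf{a}_{A,H}$. *)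

theory Defs
  imports "HOL-Algebra.Algebra" "HOL-Library.Extended_Real"
begin

section \<open>Modules over noncommutative rings\<close>

text \<open>
  Modules use the library record \<^typ>\<open>('r, 'm) module\<close>, whose multiplicative fields carry no
  meaning here; the library locale of the same name needs a commutative ring. Right modules over
  \<open>R\<close> are left modules over the opposite ring.

  Statements about all modules over a ring (injectivity, projectivity, dimensions) and about the
  existence of resolutions are relative to modules whose elements are taken from a type \<open>'u\<close>,
  which plays the role of a universe. If \<open>R\<close> is infinite and noetherian, then as soon as \<open>'u\<close> has
  at least the cardinality of \<open>R\<close>, a copy of every cyclic module lives on \<open>'u\<close>, and the modules on
  \<open>'u\<close> are closed up to isomorphism under quotients, free covers and injective hulls; by the
  criteria of Baer and Auslander the relative notions are then the absolute ones.
\<close>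

definition lmodule :: "('r, 'x) ring_scheme \<Rightarrow> ('r, 'm, 'y) module_scheme \<Rightarrow> bool" where
  "lmodule R M \<longleftrightarrow> ring R \<and> abelian_group M \<and>
     (\<forall>r\<in>carrier R. \<forall>x\<in>carrier M. r \<odot>\<^bsub>M\<^esub> x \<in> carrier M) \<and>
     (\<forall>r\<in>carrier R. \<forall>s\<in>carrier R. \<forall>x\<in>carrier M.
        (r \<oplus>\<^bsub>R\<^esub> s) \<odot>\<^bsub>M\<^esub> x = r \<odot>\<^bsub>M\<^esub> x \<oplus>\<^bsub>M\<^esub> s \<odot>\<^bsub>M\<^esub> x) \<and>
     (\<forall>r\<in>carrier R. \<forall>x\<in>carrier M. \<forall>y\<in>carrier M.
        r \<odot>\<^bsub>M\<^esub> (x \<oplus>\<^bsub>M\<^esub> y) = r \<odot>\<^bsub>M\<^esub> x \<oplus>\<^bsub>M\<^esub> r \<odot>\<^bsub>M\<^esub> y) \<and>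
     (\<forall>r\<in>carrier R. \<forall>s\<in>carrier R. \<forall>x\<in>carrier M.
        (r \<otimes>\<^bsub>R\<^esub> s) \<odot>\<^bsub>M\<^esub> x = r \<odot>\<^bsub>M\<^esub> (s \<odot>\<^bsub>M\<^esub> x)) \<and>
     (\<forall>x\<in>carrier M. \<one>\<^bsub>R\<^esub> \<odot>\<^bsub>M\<^esub> x = x)"

definition lhom ::
  "('r, 'x) ring_scheme \<Rightarrow> ('r, 'm, 'y) module_scheme \<Rightarrow> ('r, 'n, 'z) module_scheme \<Rightarrow> ('m \<Rightarrow> 'n) set"
where
  "lhom R M N = {f \<in> carrier M \<rightarrow>\<^sub>E carrier N.
     (\<forall>x\<in>carrier M. \<forall>y\<in>carrier M. f (x \<oplus>\<^bsub>M\<^esub> y) = f x \<oplus>\<^bsub>N\<^esub> f y) \<and>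
     (\<forall>r\<in>carrier R. \<forall>x\<in>carrier M. f (r \<odot>\<^bsub>M\<^esub> x) = r \<odot>\<^bsub>N\<^esub> f x)}"

definition opp :: "('a, 'x) ring_scheme \<Rightarrow> ('a, 'x) ring_scheme" where
  "opp R = R\<lparr>monoid.mult := (\<lambda>x y. y \<otimes>\<^bsub>R\<^esub> x)\<rparr>"

definition regular :: "('a, 'x) ring_scheme \<Rightarrow> ('a, 'a) module" where
  "regular R = \<lparr>carrier = carrier R, monoid.mult = monoid.mult R, one = one R,
                ring.zero = ring.zero R, add = add R,
                smult = monoid.mult R\<rparr>"

definition quot_module :: "('r, 'm, 'y) module_scheme \<Rightarrow> 'm set \<Rightarrow> ('r, 'm set) module" where
  "quot_module M N = \<lparr>carrier = a_rcosets\<^bsub>M\<^esub> N, monoid.mult = undefined, one = undefined, ring.zero = N,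
     add = set_add M, smult = (\<lambda>r Y. \<Union>x\<in>Y. N +>\<^bsub>M\<^esub> (r \<odot>\<^bsub>M\<^esub> x))\<rparr>"

definition is_zero_module :: "('m, 'y) ring_scheme \<Rightarrow> bool" where
  "is_zero_module M \<longleftrightarrow> carrier M = {\<zero>\<^bsub>M\<^esub>}"

definition injective_module :: "('r, 'x) ring_scheme \<Rightarrow> ('r, 'u) module \<Rightarrow> bool" where
  "injective_module R E \<longleftrightarrow> lmodule R E \<and>
     (\<forall>(M :: ('r, 'u) module) (N :: ('r, 'u) module).
        lmodule R M \<longrightarrow> lmodule R N \<longrightarrow>
        (\<forall>f\<in>lhom R M N. \<forall>g\<in>lhom R M E. inj_on f (carrier M) \<longrightarrow>
           (\<exists>h\<in>lhom R N E. \<forall>x\<in>carrier M. h (f x) = g x)))"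

definition projective_module :: "('r, 'x) ring_scheme \<Rightarrow> ('r, 'u) module \<Rightarrow> bool" where
  "projective_module R P \<longleftrightarrow> lmodule R P \<and>
     (\<forall>(M :: ('r, 'u) module) (N :: ('r, 'u) module).
        lmodule R M \<longrightarrow> lmodule R N \<longrightarrow>
        (\<forall>f\<in>lhom R M N. \<forall>g\<in>lhom R P N. f ` carrier M = carrier N \<longrightarrow>
           (\<exists>h\<in>lhom R P M. \<forall>x\<in>carrier P. f (h x) = g x)))"

text \<open>Exactness of \<open>0 \<rightarrow> M \<rightarrow> I\<^sup>0 \<rightarrow> I\<^sup>1 \<rightarrow> \<dots>\<close> and of \<open>\<dots> \<rightarrow> P\<^sub>1 \<rightarrow> P\<^sub>0 \<rightarrow> M \<rightarrow> 0\<close>.\<close>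

definition coresolution ::
  "('r, 'x) ring_scheme \<Rightarrow> ('r, 'm) module \<Rightarrow> (nat \<Rightarrow> ('r, 'u) module) \<Rightarrow> ('m \<Rightarrow> 'u) \<Rightarrow>
   (nat \<Rightarrow> 'u \<Rightarrow> 'u) \<Rightarrow> bool"
where
  "coresolution R M I \<iota> \<delta> \<longleftrightarrow> lmodule R M \<and> (\<forall>i. lmodule R (I i)) \<and>
     \<iota> \<in> lhom R M (I 0) \<and> (\<forall>i. \<delta> i \<in> lhom R (I i) (I (Suc i))) \<and>
     inj_on \<iota> (carrier M) \<and>
     \<iota> ` carrier M = a_kernel (I 0) (I 1) (\<delta> 0) \<and>
     (\<forall>i. \<delta> i ` carrier (I i) = a_kernel (I (Suc i)) (I (Suc (Suc i))) (\<delta> (Suc i)))"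

definition resolution ::
  "('r, 'x) ring_scheme \<Rightarrow> ('r, 'm) module \<Rightarrow> (nat \<Rightarrow> ('r, 'u) module) \<Rightarrow> ('u \<Rightarrow> 'm) \<Rightarrow>
   (nat \<Rightarrow> 'u \<Rightarrow> 'u) \<Rightarrow> bool"
where
  "resolution R M P \<pi> \<delta> \<longleftrightarrow> lmodule R M \<and> (\<forall>i. lmodule R (P i)) \<and>
     \<pi> \<in> lhom R (P 0) M \<and> (\<forall>i. \<delta> i \<in> lhom R (P (Suc i)) (P i)) \<and>
     \<pi> ` carrier (P 0) = carrier M \<and>
     \<delta> 0 ` carrier (P 1) = a_kernel (P 0) M \<pi> \<and>
     (\<forall>i. \<delta> (Suc i) ` carrier (P (Suc (Suc i))) = a_kernel (P (Suc i)) (P i) (\<delta> i))"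

definition inj_dim_le ::
  "'u itself \<Rightarrow> ('r, 'x) ring_scheme \<Rightarrow> ('r, 'm) module \<Rightarrow> nat \<Rightarrow> bool"
where
  "inj_dim_le U R M n \<longleftrightarrow> (\<exists>(I :: nat \<Rightarrow> ('r, 'u) module) \<iota> \<delta>. coresolution R M I \<iota> \<delta> \<and>
     (\<forall>i. injective_module R (I i)) \<and> (\<forall>i>n. is_zero_module (I i)))"

definition inj_dim ::
  "'u itself \<Rightarrow> ('r, 'x) ring_scheme \<Rightarrow> ('r, 'm) module \<Rightarrow> nat \<Rightarrow> bool"
where
  "inj_dim U R M n \<longleftrightarrow> inj_dim_le U R M n \<and> (\<forall>k<n. \<not> inj_dim_le U R M k)"

definition proj_dim_le :: "('r, 'x) ring_scheme \<Rightarrow> ('r, 'u) module \<Rightarrow> nat \<Rightarrow> bool" where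
  "proj_dim_le R M n \<longleftrightarrow> (\<exists>(P :: nat \<Rightarrow> ('r, 'u) module) \<pi> \<delta>. resolution R M P \<pi> \<delta> \<and>
     (\<forall>i. projective_module R (P i)) \<and> (\<forall>i>n. is_zero_module (P i)))"

definition finite_left_gldim :: "'u itself \<Rightarrow> ('r, 'x) ring_scheme \<Rightarrow> bool" where
  "finite_left_gldim U R \<longleftrightarrow>
     (\<exists>n. \<forall>M :: ('r, 'u) module. lmodule R M \<longrightarrow> proj_dim_le R M n)"

definition finite_gldim :: "'u itself \<Rightarrow> ('r, 'x) ring_scheme \<Rightarrow> bool" where
  "finite_gldim U R \<longleftrightarrow> finite_left_gldim U R \<and> finite_left_gldim U (opp R)"

definition left_ideal :: "'r set \<Rightarrow> ('r, 'x) ring_scheme \<Rightarrow> bool" where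
  "left_ideal I R \<longleftrightarrow> subgroup I (add_monoid R) \<and>
     (\<forall>r\<in>carrier R. \<forall>x\<in>I. r \<otimes>\<^bsub>R\<^esub> x \<in> I)"

definition left_noetherian :: "('r, 'x) ring_scheme \<Rightarrow> bool" where
  "left_noetherian R \<longleftrightarrow> (\<forall>I. left_ideal I R \<longrightarrow>
     (\<exists>S\<subseteq>I. finite S \<and> (\<forall>J. left_ideal J R \<and> S \<subseteq> J \<longrightarrow> I \<subseteq> J)))"

definition noetherian :: "('r, 'x) ring_scheme \<Rightarrow> bool" where
  "noetherian R \<longleftrightarrow> left_noetherian R \<and> left_noetherian (opp R)"

definition noncomm_domain :: "('r, 'x) ring_scheme \<Rightarrow> bool" where
  "noncomm_domain R \<longleftrightarrow> ring R \<and> \<one>\<^bsub>R\<^esub> \<noteq> \<zero>\<^bsub>R\<^esub> \<and>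
     (\<forall>a\<in>carrier R. \<forall>b\<in>carrier R. a \<otimes>\<^bsub>R\<^esub> b = \<zero>\<^bsub>R\<^esub> \<longrightarrow> a = \<zero>\<^bsub>R\<^esub> \<or> b = \<zero>\<^bsub>R\<^esub>)"


section \<open>Graded rings and modules\<close>

definition direct_decomposition :: "('m, 'y) ring_scheme \<Rightarrow> ('i \<Rightarrow> 'm set) \<Rightarrow> bool" where
  "direct_decomposition M mg \<longleftrightarrow> (\<forall>i. subgroup (mg i) (add_monoid M)) \<and>
     (\<forall>x\<in>carrier M. \<exists>!f. (\<forall>i. f i \<in> mg i) \<and> finite {i. f i \<noteq> \<zero>\<^bsub>M\<^esub>} \<and>
        x = (\<Oplus>\<^bsub>M\<^esub>i\<in>{i. f i \<noteq> \<zero>\<^bsub>M\<^esub>}. f i))"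

definition component :: "('m, 'y) ring_scheme \<Rightarrow> ('i \<Rightarrow> 'm set) \<Rightarrow> 'i \<Rightarrow> 'm \<Rightarrow> 'm" where
  "component M mg i x = (THE f. (\<forall>i. f i \<in> mg i) \<and> finite {i. f i \<noteq> \<zero>\<^bsub>M\<^esub>} \<and>
     x = (\<Oplus>\<^bsub>M\<^esub>i\<in>{i. f i \<noteq> \<zero>\<^bsub>M\<^esub>}. f i)) i"

definition graded_ring :: "('r, 'x) ring_scheme \<Rightarrow> (nat \<Rightarrow> 'r set) \<Rightarrow> bool" where
  "graded_ring R gr \<longleftrightarrow> ring R \<and> direct_decomposition R gr \<and>
     (\<forall>i j. \<forall>a\<in>gr i. \<forall>b\<in>gr j. a \<otimes>\<^bsub>R\<^esub> b \<in> gr (i + j))"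

definition graded_module ::
  "('r, 'x) ring_scheme \<Rightarrow> (nat \<Rightarrow> 'r set) \<Rightarrow> ('r, 'm, 'y) module_scheme \<Rightarrow> (int \<Rightarrow> 'm set) \<Rightarrow> bool"
where
  "graded_module R gr M mg \<longleftrightarrow> lmodule R M \<and> direct_decomposition M mg \<and>
     (\<forall>i j. \<forall>a\<in>gr i. \<forall>x\<in>mg j. a \<odot>\<^bsub>M\<^esub> x \<in> mg (int i + j))"

definition homs_of_degree ::
  "('r, 'x) ring_scheme \<Rightarrow> ('r, 'm, 'y) module_scheme \<Rightarrow> (int \<Rightarrow> 'm set) \<Rightarrow>
   ('r, 'n, 'z) module_scheme \<Rightarrow> (int \<Rightarrow> 'n set) \<Rightarrow> int \<Rightarrow> ('m \<Rightarrow> 'n) set"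
where
  "homs_of_degree R M mg N ng k = {f \<in> lhom R M N. \<forall>i. f ` mg i \<subseteq> ng (i + k)}"

definition graded_iso ::
  "('r, 'x) ring_scheme \<Rightarrow> ('r, 'm, 'y) module_scheme \<Rightarrow> (int \<Rightarrow> 'm set) \<Rightarrow>
   ('r, 'n, 'z) module_scheme \<Rightarrow> (int \<Rightarrow> 'n set) \<Rightarrow> bool"
where
  "graded_iso R M mg N ng \<longleftrightarrow>
     (\<exists>f\<in>lhom R M N. bij_betw f (carrier M) (carrier N) \<and> (\<forall>i. f ` mg i = ng i))"

definition int_grading :: "('r, 'x) ring_scheme \<Rightarrow> (nat \<Rightarrow> 'r set) \<Rightarrow> int \<Rightarrow> 'r set" where
  "int_grading R gr n = (if n \<ge> 0 then gr (nat n) else {\<zero>\<^bsub>R\<^esub>})"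

definition graded_injective ::
  "('r, 'x) ring_scheme \<Rightarrow> (nat \<Rightarrow> 'r set) \<Rightarrow> ('r, 'u) module \<Rightarrow> (int \<Rightarrow> 'u set) \<Rightarrow> bool"
where
  "graded_injective R gr E eg \<longleftrightarrow> graded_module R gr E eg \<and>
     (\<forall>(M :: ('r, 'u) module) mg (N :: ('r, 'u) module) ng.
        graded_module R gr M mg \<longrightarrow> graded_module R gr N ng \<longrightarrow>
        (\<forall>f\<in>homs_of_degree R M mg N ng 0. \<forall>g\<in>homs_of_degree R M mg E eg 0.
           inj_on f (carrier M) \<longrightarrow>
           (\<exists>h\<in>homs_of_degree R N ng E eg 0. \<forall>x\<in>carrier M. h (f x) = g x)))"

definition graded_inj_resolution ::
  "('r, 'x) ring_scheme \<Rightarrow> (nat \<Rightarrow> 'r set) \<Rightarrow> ('r, 'm) module \<Rightarrow> (int \<Rightarrow> 'm set) \<Rightarrow>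
   (nat \<Rightarrow> ('r, 'u) module) \<Rightarrow> (nat \<Rightarrow> int \<Rightarrow> 'u set) \<Rightarrow> ('m \<Rightarrow> 'u) \<Rightarrow> (nat \<Rightarrow> 'u \<Rightarrow> 'u) \<Rightarrow> bool"
where
  "graded_inj_resolution R gr M mg I ig \<iota> \<delta> \<longleftrightarrow> coresolution R M I \<iota> \<delta> \<and>
     graded_module R gr M mg \<and> (\<forall>i. graded_injective R gr (I i) (ig i)) \<and>
     \<iota> \<in> homs_of_degree R M mg (I 0) (ig 0) 0 \<and>
     (\<forall>i. \<delta> i \<in> homs_of_degree R (I i) (ig i) (I (Suc i)) (ig (Suc i)) 0)"

definition graded_proj_resolution ::
  "('r, 'x) ring_scheme \<Rightarrow> (nat \<Rightarrow> 'r set) \<Rightarrow> ('r, 'm) module \<Rightarrow> (int \<Rightarrow> 'm set) \<Rightarrow>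
   (nat \<Rightarrow> ('r, 'u) module) \<Rightarrow> (nat \<Rightarrow> int \<Rightarrow> 'u set) \<Rightarrow> ('u \<Rightarrow> 'm) \<Rightarrow> (nat \<Rightarrow> 'u \<Rightarrow> 'u) \<Rightarrow> bool"
where
  "graded_proj_resolution R gr M mg P pg \<pi> \<delta> \<longleftrightarrow> resolution R M P \<pi> \<delta> \<and>
     graded_module R gr M mg \<and>
     (\<forall>i. graded_module R gr (P i) (pg i) \<and> projective_module R (P i)) \<and>
     \<pi> \<in> homs_of_degree R (P 0) (pg 0) M mg 0 \<and>
     (\<forall>i. \<delta> i \<in> homs_of_degree R (P (Suc i)) (pg (Suc i)) (P i) (pg i) 0)"

subsection \<open>Cohomology of a cochain complex of graded modules\<close>

definition coboundaries ::
  "(nat \<Rightarrow> ('r, 'm) module) \<Rightarrow> (nat \<Rightarrow> 'm \<Rightarrow> 'm) \<Rightarrow> nat \<Rightarrow> 'm set"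
where
  "coboundaries C d i = (case i of 0 \<Rightarrow> {\<zero>\<^bsub>C 0\<^esub>} | Suc j \<Rightarrow> d j ` carrier (C j))"

definition cocycles ::
  "(nat \<Rightarrow> ('r, 'm) module) \<Rightarrow> (nat \<Rightarrow> 'm \<Rightarrow> 'm) \<Rightarrow> nat \<Rightarrow> 'm set"
where
  "cocycles C d i = a_kernel (C i) (C (Suc i)) (d i)"

definition cohomology ::
  "(nat \<Rightarrow> ('r, 'm) module) \<Rightarrow> (nat \<Rightarrow> 'm \<Rightarrow> 'm) \<Rightarrow> nat \<Rightarrow> ('r, 'm set) module"
where
  "cohomology C d i = quot_module ((C i)\<lparr>carrier := cocycles C d i\<rparr>) (coboundaries C d i)"

definition cohomology_grading ::
  "(nat \<Rightarrow> ('r, 'm) module) \<Rightarrow> (nat \<Rightarrow> int \<Rightarrow> 'm set) \<Rightarrow> (nat \<Rightarrow> 'm \<Rightarrow> 'm) \<Rightarrow> nat \<Rightarrow>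
   int \<Rightarrow> 'm set set"
where
  "cohomology_grading C cg d i n =
     (\<lambda>x. coboundaries C d i +>\<^bsub>C i\<^esub> x) ` (cocycles C d i \<inter> cg i n)"


section \<open>Artin-Schelter regular algebras\<close>

definition char_zero :: "('k, 'x) ring_scheme \<Rightarrow> bool" where
  "char_zero K \<longleftrightarrow> (\<forall>n::nat. n > 0 \<longrightarrow> [n] \<cdot>\<^bsub>K\<^esub> \<one>\<^bsub>K\<^esub> \<noteq> \<zero>\<^bsub>K\<^esub>)"

text \<open>The library locale of associative algebras is restricted to commutative ones.\<close>

definition assoc_algebra :: "('k, 'x) ring_scheme \<Rightarrow> ('k, 'a, 'y) module_scheme \<Rightarrow> bool" where
  "assoc_algebra K A \<longleftrightarrow> module K A \<and> ring A \<and>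
     (\<forall>c\<in>carrier K. \<forall>a\<in>carrier A. \<forall>b\<in>carrier A.
        c \<odot>\<^bsub>A\<^esub> (a \<otimes>\<^bsub>A\<^esub> b) = (c \<odot>\<^bsub>A\<^esub> a) \<otimes>\<^bsub>A\<^esub> b \<and>
        c \<odot>\<^bsub>A\<^esub> (a \<otimes>\<^bsub>A\<^esub> b) = a \<otimes>\<^bsub>A\<^esub> (c \<odot>\<^bsub>A\<^esub> b))"

definition scalars :: "('k, 'x) ring_scheme \<Rightarrow> ('k, 'a, 'y) module_scheme \<Rightarrow> 'a set" where
  "scalars K A = (\<lambda>c. c \<odot>\<^bsub>A\<^esub> \<one>\<^bsub>A\<^esub>) ` carrier K"

definition connected_graded ::
  "('k, 'x) ring_scheme \<Rightarrow> ('k, 'a, 'y) module_scheme \<Rightarrow> (nat \<Rightarrow> 'a set) \<Rightarrow> bool"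
where
  "connected_graded K A gr \<longleftrightarrow> field K \<and> assoc_algebra K A \<and> graded_ring A gr \<and>
     \<one>\<^bsub>A\<^esub> \<noteq> \<zero>\<^bsub>A\<^esub> \<and> gr 0 = scalars K A"

definition generated_in_degree_one ::
  "('k, 'x) ring_scheme \<Rightarrow> ('k, 'a, 'y) module_scheme \<Rightarrow> (nat \<Rightarrow> 'a set) \<Rightarrow> bool"
where
  "generated_in_degree_one K A gr \<longleftrightarrow> carrier A = generate_ring A (scalars K A \<union> gr 1)"

text \<open>The subspace spanned by all products of at most \<open>n\<close> elements of \<open>V\<close>.\<close>

definition power_sum_space ::
  "('k, 'x) ring_scheme \<Rightarrow> ('k, 'a, 'y) module_scheme \<Rightarrow> 'a set \<Rightarrow> nat \<Rightarrow> 'a set"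
where
  "power_sum_space K A V n = generate (add_monoid A)
     {c \<odot>\<^bsub>A\<^esub> foldr (\<otimes>\<^bsub>A\<^esub>) xs \<one>\<^bsub>A\<^esub> | c xs. c \<in> carrier K \<and> set xs \<subseteq> V \<and> length xs \<le> n}"

definition gk_dim :: "('k, 'x) ring_scheme \<Rightarrow> ('k, 'a, 'y) module_scheme \<Rightarrow> ereal" where
  "gk_dim K A = (SUP V\<in>{V. V \<subseteq> carrier A \<and> ring.finite_dimension A (scalars K A) V}.
     limsup (\<lambda>n. ereal (log (real n) (real (ring.dim A (scalars K A) (power_sum_space K A V n))))))"

text \<open>
  The trivial module \<open>A / A\<^sub>\<ge>\<^sub>1\<close> of a connected graded ring, realized on \<open>A\<^sub>0\<close>, and the grading of its
  shift by \<open>l\<close>, where \<open>M(l)\<^sub>n = M\<^sub>l\<^sub>+\<^sub>n\<close>.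
\<close>

definition trivial_module :: "('a, 'x) ring_scheme \<Rightarrow> (nat \<Rightarrow> 'a set) \<Rightarrow> ('a, 'a) module" where
  "trivial_module A gr = \<lparr>carrier = gr 0, monoid.mult = monoid.mult A, one = one A, ring.zero = ring.zero A, add = add A,
     smult = (\<lambda>a x. component A gr 0 a \<otimes>\<^bsub>A\<^esub> x)\<rparr>"

definition trivial_shift :: "('a, 'x) ring_scheme \<Rightarrow> (nat \<Rightarrow> 'a set) \<Rightarrow> int \<Rightarrow> int \<Rightarrow> 'a set" where
  "trivial_shift A gr l n = (if l + n = 0 then gr 0 else {\<zero>\<^bsub>A\<^esub>})"

text \<open>\<open>Hom\<^sub>A(P, A)\<close> for a left module \<open>P\<close>, as a right \<open>A\<close>-module via \<open>(f a)(x) = f(x) a\<close>.\<close>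

definition hom_to_regular ::
  "('a, 'x) ring_scheme \<Rightarrow> ('a, 'm) module \<Rightarrow> ('a, 'm \<Rightarrow> 'a) module"
where
  "hom_to_regular A P = \<lparr>carrier = lhom A P (regular A), monoid.mult = undefined, one = undefined,
     ring.zero = (\<lambda>x\<in>carrier P. \<zero>\<^bsub>A\<^esub>),
     add = (\<lambda>f g. \<lambda>x\<in>carrier P. f x \<oplus>\<^bsub>A\<^esub> g x),
     smult = (\<lambda>a f. \<lambda>x\<in>carrier P. f x \<otimes>\<^bsub>A\<^esub> a)\<rparr>"

definition hom_complex_grading ::
  "('a, 'x) ring_scheme \<Rightarrow> (nat \<Rightarrow> 'a set) \<Rightarrow> (nat \<Rightarrow> ('a, 'u) module) \<Rightarrow> (nat \<Rightarrow> int \<Rightarrow> 'u set) \<Rightarrow>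
   nat \<Rightarrow> int \<Rightarrow> ('u \<Rightarrow> 'a) set"
where
  "hom_complex_grading A gr P pg i =
     homs_of_degree A (P i) (pg i) (regular A) (int_grading A gr)"

definition hom_complex_diff ::
  "(nat \<Rightarrow> ('a, 'u) module) \<Rightarrow> (nat \<Rightarrow> 'u \<Rightarrow> 'u) \<Rightarrow> nat \<Rightarrow> ('u \<Rightarrow> 'a) \<Rightarrow> ('u \<Rightarrow> 'a)"
where
  "hom_complex_diff P \<delta> i f = (\<lambda>x\<in>carrier (P (Suc i)). f (\<delta> i x))"

text \<open>
  \<open>Ext\<^sup>i(k, A)\<close> of left \<open>A\<close>-modules vanishes for \<open>i \<noteq> d\<close> and is \<open>k(l)\<close> as a graded right module for
  \<open>i = d\<close>; \<open>Ext\<close> is computed with a graded projective resolution of \<open>k\<close>.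
\<close>

definition ext_condition ::
  "'u itself \<Rightarrow> ('a, 'x) ring_scheme \<Rightarrow> (nat \<Rightarrow> 'a set) \<Rightarrow> nat \<Rightarrow> int \<Rightarrow> bool"
where
  "ext_condition U A gr d l \<longleftrightarrow>
     (\<exists>(P :: nat \<Rightarrow> ('a, 'u) module) pg \<pi> \<delta>.
        graded_proj_resolution A gr (trivial_module A gr) (trivial_shift A gr 0) P pg \<pi> \<delta> \<and>
        (let C = (\<lambda>i. hom_to_regular A (P i));
             D = hom_complex_diff P \<delta>;
             cg = hom_complex_grading A gr P pg
         in (\<forall>i. i \<noteq> d \<longrightarrow> is_zero_module (cohomology C D i)) \<and>
            graded_iso (opp A) (cohomology C D d) (cohomology_grading C cg D d)
              (trivial_module (opp A) gr) (trivial_shift A gr l)))"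

definition as_gorenstein ::
  "'u itself \<Rightarrow> ('k, 'x) ring_scheme \<Rightarrow> ('k, 'a, 'y) module_scheme \<Rightarrow> (nat \<Rightarrow> 'a set) \<Rightarrow> bool"
where
  "as_gorenstein U K A gr \<longleftrightarrow> connected_graded K A gr \<and>
     (\<exists>d l. inj_dim U A (regular A) d \<and> inj_dim U (opp A) (regular (opp A)) d \<and>
            ext_condition U A gr d l \<and> ext_condition U (opp A) gr d l)"

definition as_regular ::
  "'u itself \<Rightarrow> ('k, 'x) ring_scheme \<Rightarrow> ('k, 'a, 'y) module_scheme \<Rightarrow> (nat \<Rightarrow> 'a set) \<Rightarrow> bool"
where
  "as_regular U K A gr \<longleftrightarrow> as_gorenstein U K A gr \<and> finite_gldim U A \<and> gk_dim K A < \<infinity>"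


section \<open>The Hopf algebra of functions on a finite group\<close>

text \<open>
  \<open>(kG)\<^sup>*\<close> is the algebra of functions \<open>G \<rightarrow> k\<close> (extensional outside \<open>G\<close>), and its tensor square is the
  algebra of functions on \<open>G \<times> G\<close>.
\<close>

definition fun_alg :: "('g, 'x) monoid_scheme \<Rightarrow> ('k, 'y) ring_scheme \<Rightarrow> ('k, 'g \<Rightarrow> 'k) module" where
  "fun_alg G K = \<lparr>carrier = carrier G \<rightarrow>\<^sub>E carrier K,
     monoid.mult = (\<lambda>f h. \<lambda>x\<in>carrier G. f x \<otimes>\<^bsub>K\<^esub> h x), one = (\<lambda>x\<in>carrier G. \<one>\<^bsub>K\<^esub>),
     ring.zero = (\<lambda>x\<in>carrier G. \<zero>\<^bsub>K\<^esub>), add = (\<lambda>f h. \<lambda>x\<in>carrier G. f x \<oplus>\<^bsub>K\<^esub> h x),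
     smult = (\<lambda>c f. \<lambda>x\<in>carrier G. c \<otimes>\<^bsub>K\<^esub> f x)\<rparr>"

definition counit :: "('g, 'x) monoid_scheme \<Rightarrow> ('g \<Rightarrow> 'k) \<Rightarrow> 'k" where
  "counit G f = f \<one>\<^bsub>G\<^esub>"

definition antipode :: "('g, 'x) monoid_scheme \<Rightarrow> ('g \<Rightarrow> 'k) \<Rightarrow> 'g \<Rightarrow> 'k" where
  "antipode G f = (\<lambda>x\<in>carrier G. f (inv\<^bsub>G\<^esub> x))"

definition comult :: "('g, 'x) monoid_scheme \<Rightarrow> ('g \<Rightarrow> 'k) \<Rightarrow> 'g \<times> 'g \<Rightarrow> 'k" where
  "comult G f = restrict (\<lambda>(x, y). f (x \<otimes>\<^bsub>G\<^esub> y)) (carrier G \<times> carrier G)"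

definition pure_tensor ::
  "('g, 'x) monoid_scheme \<Rightarrow> ('k, 'y) ring_scheme \<Rightarrow> ('g \<Rightarrow> 'k) \<Rightarrow> ('g \<Rightarrow> 'k) \<Rightarrow> 'g \<times> 'g \<Rightarrow> 'k"
where
  "pure_tensor G K f h = restrict (\<lambda>(x, y). f x \<otimes>\<^bsub>K\<^esub> h y) (carrier G \<times> carrier G)"

definition point_fun :: "('g, 'x) monoid_scheme \<Rightarrow> ('k, 'y) ring_scheme \<Rightarrow> 'g \<Rightarrow> 'g \<Rightarrow> 'k" where
  "point_fun G K g = (\<lambda>x\<in>carrier G. if x = g then \<one>\<^bsub>K\<^esub> else \<zero>\<^bsub>K\<^esub>)"

definition hopf_ideal ::
  "('g, 'x) monoid_scheme \<Rightarrow> ('k, 'y) ring_scheme \<Rightarrow> ('g \<Rightarrow> 'k) set \<Rightarrow> bool"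
where
  "hopf_ideal G K I \<longleftrightarrow> ideal I (fun_alg G K) \<and>
     (\<forall>f\<in>I. counit G f = \<zero>\<^bsub>K\<^esub>) \<and>
     antipode G ` I \<subseteq> I \<and>
     comult G ` I \<subseteq> generate (add_monoid (fun_alg (G \<times>\<times> G) K))
       {pure_tensor G K f h | f h.
          (f \<in> I \<and> h \<in> carrier (fun_alg G K)) \<or> (f \<in> carrier (fun_alg G K) \<and> h \<in> I)}"

text \<open>
  In the product rule, \<open>\<Delta>(h)\<close> is expanded in the basis of tensors of point functions, that is
  \<open>\<Delta>(h) = \<Sum>\<^sub>x\<^sub>,\<^sub>y \<Delta>(h)(x, y) p\<^sub>x \<otimes> p\<^sub>y\<close>.
\<close>

definition module_algebra ::
  "('g, 'x) monoid_scheme \<Rightarrow> ('k, 'y) ring_scheme \<Rightarrow> ('k, 'a, 'z) module_scheme \<Rightarrow>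
   (('g \<Rightarrow> 'k) \<Rightarrow> 'a \<Rightarrow> 'a) \<Rightarrow> bool"
where
  "module_algebra G K A act \<longleftrightarrow> (let H = fun_alg G K in
     (\<forall>h\<in>carrier H. \<forall>a\<in>carrier A. act h a \<in> carrier A) \<and>
     (\<forall>h\<in>carrier H. \<forall>a\<in>carrier A. \<forall>b\<in>carrier A.
        act h (a \<oplus>\<^bsub>A\<^esub> b) = act h a \<oplus>\<^bsub>A\<^esub> act h b) \<and>
     (\<forall>h\<in>carrier H. \<forall>c\<in>carrier K. \<forall>a\<in>carrier A. act h (c \<odot>\<^bsub>A\<^esub> a) = c \<odot>\<^bsub>A\<^esub> act h a) \<and>
     (\<forall>h\<in>carrier H. \<forall>h'\<in>carrier H. \<forall>a\<in>carrier A.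
        act (h \<oplus>\<^bsub>H\<^esub> h') a = act h a \<oplus>\<^bsub>A\<^esub> act h' a) \<and>
     (\<forall>h\<in>carrier H. \<forall>c\<in>carrier K. \<forall>a\<in>carrier A. act (c \<odot>\<^bsub>H\<^esub> h) a = c \<odot>\<^bsub>A\<^esub> act h a) \<and>
     (\<forall>h\<in>carrier H. \<forall>h'\<in>carrier H. \<forall>a\<in>carrier A. act (h \<otimes>\<^bsub>H\<^esub> h') a = act h (act h' a)) \<and>
     (\<forall>a\<in>carrier A. act \<one>\<^bsub>H\<^esub> a = a) \<and>
     (\<forall>h\<in>carrier H. \<forall>a\<in>carrier A. \<forall>b\<in>carrier A.
        act h (a \<otimes>\<^bsub>A\<^esub> b) = (\<Oplus>\<^bsub>A\<^esub>x\<in>carrier G. \<Oplus>\<^bsub>A\<^esub>y\<in>carrier G.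
          comult G h (x, y) \<odot>\<^bsub>A\<^esub> (act (point_fun G K x) a \<otimes>\<^bsub>A\<^esub> act (point_fun G K y) b))) \<and>
     (\<forall>h\<in>carrier H. act h \<one>\<^bsub>A\<^esub> = counit G h \<odot>\<^bsub>A\<^esub> \<one>\<^bsub>A\<^esub>))"

definition acts_homogeneously ::
  "('g, 'x) monoid_scheme \<Rightarrow> ('k, 'y) ring_scheme \<Rightarrow> (nat \<Rightarrow> 'a set) \<Rightarrow>
   (('g \<Rightarrow> 'k) \<Rightarrow> 'a \<Rightarrow> 'a) \<Rightarrow> bool"
where
  "acts_homogeneously G K gr act \<longleftrightarrow> (\<forall>h\<in>carrier (fun_alg G K). \<forall>i. act h ` gr i \<subseteq> gr i)"

definition inner_faithful ::
  "('g, 'x) monoid_scheme \<Rightarrow> ('k, 'y) ring_scheme \<Rightarrow> ('k, 'a, 'z) module_scheme \<Rightarrow>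
   (('g \<Rightarrow> 'k) \<Rightarrow> 'a \<Rightarrow> 'a) \<Rightarrow> bool"
where
  "inner_faithful G K A act \<longleftrightarrow> (\<forall>I. hopf_ideal G K I \<longrightarrow>
     (\<forall>h\<in>I. \<forall>a\<in>carrier A. act h a = \<zero>\<^bsub>A\<^esub>) \<longrightarrow> I = {\<zero>\<^bsub>fun_alg G K\<^esub>})"

definition weight_space ::
  "('g, 'x) monoid_scheme \<Rightarrow> ('k, 'y) ring_scheme \<Rightarrow> ('k, 'a, 'z) module_scheme \<Rightarrow>
   (('g \<Rightarrow> 'k) \<Rightarrow> 'a \<Rightarrow> 'a) \<Rightarrow> (('g \<Rightarrow> 'k) \<Rightarrow> 'k) \<Rightarrow> 'a set"
where
  "weight_space G K A act \<chi> =
     {a \<in> carrier A. \<forall>h\<in>carrier (fun_alg G K). act h a = \<chi> h \<odot>\<^bsub>A\<^esub> a}"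

definition invariants ::
  "('g, 'x) monoid_scheme \<Rightarrow> ('k, 'y) ring_scheme \<Rightarrow> ('k, 'a, 'z) module_scheme \<Rightarrow>
   (('g \<Rightarrow> 'k) \<Rightarrow> 'a \<Rightarrow> 'a) \<Rightarrow> 'a set"
where
  "invariants G K A act = weight_space G K A act (counit G)"

definition invariant_ring ::
  "('g, 'x) monoid_scheme \<Rightarrow> ('k, 'y) ring_scheme \<Rightarrow> ('k, 'a, 'z) module_scheme \<Rightarrow>
   (('g \<Rightarrow> 'k) \<Rightarrow> 'a \<Rightarrow> 'a) \<Rightarrow> ('k, 'a, 'z) module_scheme"
where
  "invariant_ring G K A act = A\<lparr>carrier := invariants G K A act\<rparr>"

definition invariant_grading ::
  "('g, 'x) monoid_scheme \<Rightarrow> ('k, 'y) ring_scheme \<Rightarrow> ('k, 'a, 'z) module_scheme \<Rightarrow>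
   (nat \<Rightarrow> 'a set) \<Rightarrow> (('g \<Rightarrow> 'k) \<Rightarrow> 'a \<Rightarrow> 'a) \<Rightarrow> nat \<Rightarrow> 'a set"
where
  "invariant_grading G K A gr act i = gr i \<inter> invariants G K A act"

text \<open>The group of grouplike elements of \<open>kG\<close>, as algebra maps \<open>(kG)\<^sup>* \<rightarrow> k\<close>.\<close>

definition alg_characters ::
  "('g, 'x) monoid_scheme \<Rightarrow> ('k, 'y) ring_scheme \<Rightarrow> (('g \<Rightarrow> 'k) \<Rightarrow> 'k) set"
where
  "alg_characters G K = {\<chi> \<in> ring_hom (fun_alg G K) K.
     \<chi> \<in> extensional (carrier (fun_alg G K)) \<and>
     (\<forall>c\<in>carrier K. \<forall>f\<in>carrier (fun_alg G K).
        \<chi> (c \<odot>\<^bsub>fun_alg G K\<^esub> f) = c \<otimes>\<^bsub>K\<^esub> \<chi> f)}"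

definition character_inv ::
  "('g, 'x) monoid_scheme \<Rightarrow> ('k, 'y) ring_scheme \<Rightarrow> (('g \<Rightarrow> 'k) \<Rightarrow> 'k) \<Rightarrow> ('g \<Rightarrow> 'k) \<Rightarrow> 'k"
where
  "character_inv G K \<chi> = (\<lambda>h\<in>carrier (fun_alg G K). \<chi> (antipode G h))"


section \<open>Homological determinant\<close>

text \<open>
  The smash product \<open>A # (kG)\<^sup>*\<close>, an element \<open>\<Sum>\<^sub>g u(g) # p\<^sub>g\<close> being represented by the function \<open>u\<close>.
  Since \<open>\<Delta>(p\<^sub>g) = \<Sum>\<^sub>s\<^sub>t\<^sub>=\<^sub>g p\<^sub>s \<otimes> p\<^sub>t\<close>, the rule \<open>(a # x)(b # y) = \<Sum> a (x\<^sub>1 b) # x\<^sub>2 y\<close> becomes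
  \<open>(a # p\<^sub>g)(b # p\<^sub>h) = a (p\<^sub>s b) # p\<^sub>h\<close> with \<open>s = g h\<^sup>-\<^sup>1\<close>.
\<close>

definition smash ::
  "('g, 'x) monoid_scheme \<Rightarrow> ('k, 'y) ring_scheme \<Rightarrow> ('k, 'a, 'z) module_scheme \<Rightarrow>
   (('g \<Rightarrow> 'k) \<Rightarrow> 'a \<Rightarrow> 'a) \<Rightarrow> ('g \<Rightarrow> 'a) ring"
where
  "smash G K A act = \<lparr>carrier = carrier G \<rightarrow>\<^sub>E carrier A,
     monoid.mult = (\<lambda>u v. \<lambda>h\<in>carrier G. \<Oplus>\<^bsub>A\<^esub>g\<in>carrier G.
               u g \<otimes>\<^bsub>A\<^esub> act (point_fun G K (g \<otimes>\<^bsub>G\<^esub> inv\<^bsub>G\<^esub> h)) (v h)),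
     one = (\<lambda>g\<in>carrier G. \<one>\<^bsub>A\<^esub>), ring.zero = (\<lambda>g\<in>carrier G. \<zero>\<^bsub>A\<^esub>),
     add = (\<lambda>u v. \<lambda>g\<in>carrier G. u g \<oplus>\<^bsub>A\<^esub> v g)\<rparr>"

definition smash_grading ::
  "('g, 'x) monoid_scheme \<Rightarrow> (nat \<Rightarrow> 'a set) \<Rightarrow> nat \<Rightarrow> ('g \<Rightarrow> 'a) set"
where
  "smash_grading G gr n = carrier G \<rightarrow>\<^sub>E gr n"

text \<open>The embeddings \<open>a \<mapsto> a # 1\<close> and \<open>h \<mapsto> 1 # h\<close>, where \<open>1 = \<Sum>\<^sub>g p\<^sub>g\<close>.\<close>

definition smash_of_alg :: "('g, 'x) monoid_scheme \<Rightarrow> 'a \<Rightarrow> 'g \<Rightarrow> 'a" where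
  "smash_of_alg G a = (\<lambda>g\<in>carrier G. a)"

definition smash_of_hopf ::
  "('g, 'x) monoid_scheme \<Rightarrow> ('k, 'a, 'z) module_scheme \<Rightarrow> ('g \<Rightarrow> 'k) \<Rightarrow> 'g \<Rightarrow> 'a"
where
  "smash_of_hopf G A h = (\<lambda>g\<in>carrier G. h g \<odot>\<^bsub>A\<^esub> \<one>\<^bsub>A\<^esub>)"

text \<open>\<open>A\<close> as a left module over the smash product, via \<open>(a # h) b = a (h b)\<close>.\<close>

definition smash_rep ::
  "('g, 'x) monoid_scheme \<Rightarrow> ('k, 'y) ring_scheme \<Rightarrow> ('k, 'a, 'z) module_scheme \<Rightarrow>
   (('g \<Rightarrow> 'k) \<Rightarrow> 'a \<Rightarrow> 'a) \<Rightarrow> ('g \<Rightarrow> 'a, 'a) module"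
where
  "smash_rep G K A act = \<lparr>carrier = carrier A, monoid.mult = monoid.mult A, one = one A, ring.zero = ring.zero A,
     add = add A,
     smult = (\<lambda>u b. \<Oplus>\<^bsub>A\<^esub>g\<in>carrier G. u g \<otimes>\<^bsub>A\<^esub> act (point_fun G K g) b)\<rparr>"

text \<open>The elements annihilated by \<open>A\<^sub>\<ge>\<^sub>n\<close> for some \<open>n\<close>.\<close>

definition torsion ::
  "('g, 'x) monoid_scheme \<Rightarrow> (nat \<Rightarrow> 'a set) \<Rightarrow> ('g \<Rightarrow> 'a, 'm) module \<Rightarrow> 'm set"
where
  "torsion G gr M =
     {x \<in> carrier M. \<exists>n. \<forall>i\<ge>n. \<forall>a\<in>gr i. smash_of_alg G a \<odot>\<^bsub>M\<^esub> x = \<zero>\<^bsub>M\<^esub>}"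

text \<open>
  The degree \<open>m\<close> part of the graded dual, that is the linear forms on the degree \<open>-m\<close> part of a
  module over the smash product.
\<close>

definition graded_dual ::
  "('g, 'x) monoid_scheme \<Rightarrow> ('k, 'y) ring_scheme \<Rightarrow> ('k, 'a, 'z) module_scheme \<Rightarrow>
   ('g \<Rightarrow> 'a, 'm) module \<Rightarrow> (int \<Rightarrow> 'm set) \<Rightarrow> int \<Rightarrow> ('m \<Rightarrow> 'k) set"
where
  "graded_dual G K A L lg m = {\<phi> \<in> lg (- m) \<rightarrow>\<^sub>E carrier K.
     (\<forall>x\<in>lg (- m). \<forall>y\<in>lg (- m). \<phi> (x \<oplus>\<^bsub>L\<^esub> y) = \<phi> x \<oplus>\<^bsub>K\<^esub> \<phi> y) \<and>
     (\<forall>c\<in>carrier K. \<forall>x\<in>lg (- m).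
        \<phi> (smash_of_alg G (c \<odot>\<^bsub>A\<^esub> \<one>\<^bsub>A\<^esub>) \<odot>\<^bsub>L\<^esub> x) = c \<otimes>\<^bsub>K\<^esub> \<phi> x)}"

text \<open>
  \<open>\<chi>\<close> is the homological determinant: \<open>d\<close> is the injective dimension of \<open>A\<close>, \<open>L\<close> the local cohomology
  module \<open>H\<^sup>d(A)\<close> computed with graded injective modules over the smash product, \<open>n\<close> the lowest degree
  of its graded dual, and the right action on the dual is \<open>(\<phi> h)(x) = \<phi>(h x)\<close>.
\<close>

definition is_hdet ::
  "'u itself \<Rightarrow> ('g, 'x) monoid_scheme \<Rightarrow> ('k, 'y) ring_scheme \<Rightarrow> ('k, 'a, 'z) module_scheme \<Rightarrow>
   (nat \<Rightarrow> 'a set) \<Rightarrow> (('g \<Rightarrow> 'k) \<Rightarrow> 'a \<Rightarrow> 'a) \<Rightarrow> (('g \<Rightarrow> 'k) \<Rightarrow> 'k) \<Rightarrow> bool"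
where
  "is_hdet U G K A gr act \<chi> \<longleftrightarrow>
     (\<exists>d (I :: nat \<Rightarrow> ('g \<Rightarrow> 'a, 'u) module) ig \<iota> \<delta>.
        inj_dim U A (regular A) d \<and>
        graded_inj_resolution (smash G K A act) (smash_grading G gr)
          (smash_rep G K A act) (int_grading A gr) I ig \<iota> \<delta> \<and>
        (let C = (\<lambda>i. (I i)\<lparr>carrier := torsion G gr (I i)\<rparr>);
             cg = (\<lambda>i n. ig i n \<inter> torsion G gr (I i));
             L = cohomology C \<delta> d;
             lg = cohomology_grading C cg \<delta> d;
             dual = graded_dual G K A L lg
         in \<exists>n e \<eta>.
              (\<forall>m<n. dual m = {\<lambda>x\<in>lg (- m). \<zero>\<^bsub>K\<^esub>}) \<and>
              e \<in> dual n \<and> e \<noteq> (\<lambda>x\<in>lg (- n). \<zero>\<^bsub>K\<^esub>) \<and>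
              dual n = {\<lambda>x\<in>lg (- n). c \<otimes>\<^bsub>K\<^esub> e x | c. c \<in> carrier K} \<and>
              \<eta> \<in> alg_characters G K \<and>
              (\<forall>h\<in>carrier (fun_alg G K). \<forall>x\<in>lg (- n).
                 e (smash_of_hopf G A h \<odot>\<^bsub>L\<^esub> x) = \<eta> h \<otimes>\<^bsub>K\<^esub> e x) \<and>
              \<chi> = character_inv G K \<eta>))"


section \<open>Jacobian and reflection arrangement\<close>

definition generates_weight_space ::
  "('g, 'x) monoid_scheme \<Rightarrow> ('k, 'y) ring_scheme \<Rightarrow> ('k, 'a, 'z) module_scheme \<Rightarrow>
   (('g \<Rightarrow> 'k) \<Rightarrow> 'a \<Rightarrow> 'a) \<Rightarrow> (('g \<Rightarrow> 'k) \<Rightarrow> 'k) \<Rightarrow> 'a \<Rightarrow> bool"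
where
  "generates_weight_space G K A act \<chi> f \<longleftrightarrow> f \<in> carrier A \<and>
     weight_space G K A act \<chi> = (\<lambda>r. f \<otimes>\<^bsub>A\<^esub> r) ` invariants G K A act \<and>
     weight_space G K A act \<chi> = (\<lambda>r. r \<otimes>\<^bsub>A\<^esub> f) ` invariants G K A act"

definition is_jacobian ::
  "'u itself \<Rightarrow> ('g, 'x) monoid_scheme \<Rightarrow> ('k, 'y) ring_scheme \<Rightarrow> ('k, 'a, 'z) module_scheme \<Rightarrow>
   (nat \<Rightarrow> 'a set) \<Rightarrow> (('g \<Rightarrow> 'k) \<Rightarrow> 'a \<Rightarrow> 'a) \<Rightarrow> 'a \<Rightarrow> bool"
where
  "is_jacobian U G K A gr act j \<longleftrightarrow> (\<exists>\<chi>. is_hdet U G K A gr act \<chi> \<and>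
     generates_weight_space G K A act (character_inv G K \<chi>) j)"

definition is_reflection_arrangement ::
  "'u itself \<Rightarrow> ('g, 'x) monoid_scheme \<Rightarrow> ('k, 'y) ring_scheme \<Rightarrow> ('k, 'a, 'z) module_scheme \<Rightarrow>
   (nat \<Rightarrow> 'a set) \<Rightarrow> (('g \<Rightarrow> 'k) \<Rightarrow> 'a \<Rightarrow> 'a) \<Rightarrow> 'a \<Rightarrow> bool"
where
  "is_reflection_arrangement U G K A gr act a \<longleftrightarrow> (\<exists>\<chi>. is_hdet U G K A gr act \<chi> \<and>
     generates_weight_space G K A act \<chi> a)"

text \<open>
  The Jacobian and the reflection arrangement are determined only up to a nonzero scalar. The scalar
  \<open>c\<close> is needed for the empty product only; otherwise it can be absorbed into a factor.
\<close>

definition product_of_degree_one ::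
  "('k, 'y) ring_scheme \<Rightarrow> ('k, 'a, 'z) module_scheme \<Rightarrow> (nat \<Rightarrow> 'a set) \<Rightarrow> 'a \<Rightarrow> bool"
where
  "product_of_degree_one K A gr f \<longleftrightarrow> (\<exists>c xs. c \<in> carrier K \<and> c \<noteq> \<zero>\<^bsub>K\<^esub> \<and> set xs \<subseteq> gr 1 \<and>
     f = c \<odot>\<^bsub>A\<^esub> foldr (\<otimes>\<^bsub>A\<^esub>) xs \<one>\<^bsub>A\<^esub>)"

end

theory Submission
  imports Defs
begin

text \<open>
  The action of \<open>(kG)\<^sup>*\<close> is a \<open>G\<close>-grading of \<open>A\<close>, and a nonzero weight space is one of its components
  \<open>A\<^sub>g\<close>. As \<open>A\<close> is generated in degree one, \<open>A\<^sub>g\<close> is spanned by monomials in elements of degree one.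
  Suppose \<open>A\<^sub>g = f R\<close> with \<open>f \<noteq> 0\<close>, and write each monomial \<open>m\<close> in \<open>A\<^sub>g\<close> as \<open>f r\<close>. If every such \<open>r\<close> had
  zero constant term, then so would some \<open>r\<close> with \<open>f = f r\<close>, that is \<open>r = 1\<close>. So some \<open>r\<close> has a nonzero
  constant term; being a factor of a homogeneous element of a graded domain, it is homogeneous, hence
  a scalar, and \<open>f\<close> is a scalar multiple of \<open>m\<close>. Of the homological determinant only its being
  \<open>k\<close>-valued matters.
\<close>

section \<open>Homogeneous components\<close>

locale graded_ring_components = ring R for R (structure) +
  fixes gr :: "nat \<Rightarrow> 'a set"
  assumes graded: "graded_ring R gr"
begin

abbreviation comp :: "nat \<Rightarrow> 'a \<Rightarrow> 'a" where
  "comp \<equiv> component R gr"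

lemma gr_subgroup: "subgroup (gr i) (add_monoid R)"
  using graded by (simp add: graded_ring_def direct_decomposition_def)

lemma gr_closed: "x \<in> gr i \<Longrightarrow> x \<in> carrier R"
  using subgroup.mem_carrier[OF gr_subgroup] by simp

lemma gr_zero: "\<zero> \<in> gr i"
  using subgroup.one_closed[OF gr_subgroup] by simp

lemma gr_add: "x \<in> gr i \<Longrightarrow> y \<in> gr i \<Longrightarrow> x \<oplus> y \<in> gr i"
  using subgroup.m_closed[OF gr_subgroup] by simp

lemma gr_mult: "x \<in> gr i \<Longrightarrow> y \<in> gr j \<Longrightarrow> x \<otimes> y \<in> gr (i + j)"
  using graded by (simp add: graded_ring_def)

lemma decomposition_ex1:
  assumes "x \<in> carrier R"
  shows "\<exists>!f. (\<forall>i. f i \<in> gr i) \<and> finite {i. f i \<noteq> \<zero>} \<and> x = (\<Oplus>i\<in>{i. f i \<noteq> \<zero>}. f i)"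
  using graded assms by (simp add: graded_ring_def direct_decomposition_def)

lemma
  assumes "x \<in> carrier R"
  shows comp_in_gr: "comp i x \<in> gr i"
    and finite_support: "finite {i. comp i x \<noteq> \<zero>}"
    and sum_comp: "x = (\<Oplus>i\<in>{i. comp i x \<noteq> \<zero>}. comp i x)"
  using theI'[OF decomposition_ex1[OF assms]] unfolding component_def by auto

lemma comp_closed: "x \<in> carrier R \<Longrightarrow> comp i x \<in> carrier R"
  using comp_in_gr gr_closed by blast

text \<open>\<open>component\<close> is given by a definite description, so uniqueness of the
  decomposition identifies any candidate family \<open>f\<close> with it. The set \<open>B\<close>
  may exceed the support of \<open>f\<close>, which lets families with different supports be summed
  over one index set.\<close>

lemma comp_eqI:
  assumes f: "\<And>i. f i \<in> gr i" and B: "finite B" "\<And>i. i \<notin> B \<Longrightarrow> f i = \<zero>"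
    and x: "x = (\<Oplus>i\<in>B. f i)"
  shows "comp i x = f i"
proof -
  have fc: "\<And>i. f i \<in> carrier R"
    using f gr_closed by blast
  have sub: "{i. f i \<noteq> \<zero>} \<subseteq> B"
    using B(2) by blast
  have sum: "x = (\<Oplus>i\<in>{i. f i \<noteq> \<zero>}. f i)"
    unfolding x by (rule add.finprod_mono_neutral_cong_left[symmetric]) (use B sub fc in auto)
  have xc: "x \<in> carrier R"
    unfolding x using fc by (simp add: finsum_closed)
  have "component R gr = (\<lambda>i x. (THE f. (\<forall>i. f i \<in> gr i) \<and> finite {i. f i \<noteq> \<zero>} \<and>
      x = (\<Oplus>i\<in>{i. f i \<noteq> \<zero>}. f i)) i)"
    unfolding component_def ..
  moreover have "(THE f. (\<forall>i. f i \<in> gr i) \<and> finite {i. f i \<noteq> \<zero>} \<and>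
      x = (\<Oplus>i\<in>{i. f i \<noteq> \<zero>}. f i)) = f"
    by (rule the1_equality[OF decomposition_ex1[OF xc]])
      (use f sum finite_subset[OF sub B(1)] in blast)
  ultimately show ?thesis
    by simp
qed

lemma comp_gr:
  assumes "x \<in> gr n"
  shows "comp i x = (if i = n then x else \<zero>)"
  by (rule comp_eqI[where B = "{n}"]) (use assms gr_closed gr_zero in auto)

lemma comp_zero: "comp i \<zero> = \<zero>"
  using comp_gr[OF gr_zero] by simp

lemma comp_add:
  assumes xy: "x \<in> carrier R" "y \<in> carrier R"
  shows "comp i (x \<oplus> y) = comp i x \<oplus> comp i y"
proof (rule comp_eqI)
  let ?B = "{i. comp i x \<noteq> \<zero>} \<union> {i. comp i y \<noteq> \<zero>}"
  show fin: "finite ?B"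
    using xy finite_support by simp
  \<comment> \<open>Both decompositions are padded with zeros to the union of the two
    supports.\<close>
  have sum: "z = (\<Oplus>i\<in>?B. comp i z)" if "{i. comp i z \<noteq> \<zero>} \<subseteq> ?B" "z \<in> carrier R" for z
    by (subst (1) sum_comp[OF that(2)], rule add.finprod_mono_neutral_cong_left)
      (use fin that comp_closed in auto)
  have "x \<oplus> y = (\<Oplus>i\<in>?B. comp i x) \<oplus> (\<Oplus>i\<in>?B. comp i y)"
    using sum[of x] sum[of y] xy by auto
  also have "\<dots> = (\<Oplus>i\<in>?B. comp i x \<oplus> comp i y)"
    using xy by (intro finsum_addf[symmetric]) (auto simp: comp_closed)
  finally show "x \<oplus> y = (\<Oplus>i\<in>?B. comp i x \<oplus> comp i y)" .
qed (use xy comp_in_gr gr_add in auto)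

text \<open>Every element is the finite sum of its components, so an additive property need only be
  checked on homogeneous elements.\<close>

lemma homogeneous_induct [consumes 1, case_names zero add homogeneous]:
  assumes x: "x \<in> carrier R"
    and zero: "P \<zero>"
    and add: "\<And>x y. x \<in> carrier R \<Longrightarrow> y \<in> carrier R \<Longrightarrow> P x \<Longrightarrow> P y \<Longrightarrow> P (x \<oplus> y)"
    and homogeneous: "\<And>x i. x \<in> gr i \<Longrightarrow> P x"
  shows "P x"
proof -
  have "P (\<Oplus>i\<in>B. comp i x)" if "finite B" for B
    using that
  proof (induction B rule: finite_induct)
    case (insert i B)
    then show ?case
      using x homogeneous[OF comp_in_gr[OF x]]
      by (subst finsum_insert) (auto intro!: add finsum_closed simp: comp_closed)
  qed (simp add: zero)
  then show ?thesis
    using sum_comp[OF x] finite_support[OF x] by metis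
qed

text \<open>Both sides are additive in \<open>x\<close> and in \<open>y\<close>, so two nested
  inductions reduce the formula to homogeneous factors. The subtraction \<open>n - i\<close> is
  never truncated, because \<open>i \<le> n\<close>.\<close>

lemma comp_mult:
  assumes x: "x \<in> carrier R" and y: "y \<in> carrier R"
  shows "comp n (x \<otimes> y) = (\<Oplus>i\<in>{..n}. comp i x \<otimes> comp (n - i) y)"
  using x
proof (induction x rule: homogeneous_induct)
  case zero
  then show ?case
    using y by (simp add: comp_zero comp_closed)
next
  case (add x x')
  then show ?case
    using y by (simp add: l_distr comp_add comp_closed finsum_addf Pi_def)
next
  case (homogeneous x i)
  note x = this
  show ?case
    using y
  proof (induction y rule: homogeneous_induct)
    case zero
    then show ?case
      using gr_closed[OF x] by (simp add: comp_zero comp_closed)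
  next
    case (add y y')
    then show ?case
      using gr_closed[OF x] by (simp add: r_distr comp_add comp_closed finsum_addf Pi_def)
  next
    case (homogeneous y j)
    note y = this
    have c: "x \<in> carrier R" "y \<in> carrier R"
      using x y gr_closed by auto
    \<comment> \<open>With \<open>x\<close> of degree \<open>i\<close> and \<open>y\<close> of
      degree \<open>j\<close>, only the summand at \<open>k = i\<close> can survive, and only when
      \<open>n = i + j\<close>.\<close>
    have "(\<Oplus>k\<in>{..n}. comp k x \<otimes> comp (n - k) y)
        = (\<Oplus>k\<in>{..n}. if i = k then (if n = i + j then x \<otimes> y else \<zero>) else \<zero>)"
      by (rule finsum_cong') (use c in \<open>auto simp: comp_gr[OF x] comp_gr[OF y]\<close>)
    also have "\<dots> = comp n (x \<otimes> y)"
    proof (cases "i \<le> n")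
      case True
      then show ?thesis
        using c by (subst add.finprod_singleton) (auto simp: comp_gr[OF gr_mult[OF x y]])
    next
      case False
      then have "(\<Oplus>k\<in>{..n}. if i = k then (if n = i + j then x \<otimes> y else \<zero>) else \<zero>)
          = (\<Oplus>k\<in>{..n}. \<zero>)"
        by (intro finsum_cong') auto
      then show ?thesis
        using False by (auto simp: comp_gr[OF gr_mult[OF x y]])
    qed
    finally show ?case ..
  qed
qed

text \<open>The hypothesis \<open>ext\<close> kills every summand of \<open>comp_mult\<close> except
  the one at \<open>i = p\<close>. It is met by the lowest, and likewise by the highest, degrees
  occurring in \<open>x\<close> and \<open>y\<close>.\<close>

lemma comp_mult_extremal:
  assumes x: "x \<in> carrier R" and y: "y \<in> carrier R"
    and ext: "\<And>i j. i + j = p + q \<Longrightarrow> i \<noteq> p \<Longrightarrow> comp i x = \<zero> \<or> comp j y = \<zero>"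
  shows "comp (p + q) (x \<otimes> y) = comp p x \<otimes> comp q y"
proof -
  have "comp (p + q) (x \<otimes> y)
      = (\<Oplus>i\<in>{..p + q}. if p = i then comp i x \<otimes> comp (p + q - i) y else \<zero>)"
    unfolding comp_mult[OF x y]
  proof (rule finsum_cong')
    fix i
    assume "i \<in> {..p + q}"
    then have "p \<noteq> i \<Longrightarrow> comp i x = \<zero> \<or> comp (p + q - i) y = \<zero>"
      using ext[of i "p + q - i"] by auto
    then show "comp i x \<otimes> comp (p + q - i) y
        = (if p = i then comp i x \<otimes> comp (p + q - i) y else \<zero>)"
      using x y comp_closed by auto
  qed (use x y comp_closed in auto)
  also have "\<dots> = comp p x \<otimes> comp q y"
    using x y comp_closed by (subst add.finprod_singleton) auto
  finally show ?thesis .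
qed

lemma nonzero_comp_ex:
  assumes "x \<in> carrier R" "x \<noteq> \<zero>"
  shows "\<exists>i. comp i x \<noteq> \<zero>"
proof (rule ccontr)
  assume "\<nexists>i. comp i x \<noteq> \<zero>"
  then show False
    using sum_comp[OF assms(1)] assms(2) by simp
qed

text \<open>
  In a domain the product of the lowest components of \<open>x\<close> and \<open>y\<close> does not vanish, nor does that of
  the highest ones, so both have degree \<open>n\<close>.
\<close>

lemma right_factor_homogeneous:
  assumes dom: "noncomm_domain R"
    and x: "x \<in> carrier R" and y: "y \<in> carrier R"
    and xy: "x \<otimes> y \<in> gr n" "x \<otimes> y \<noteq> \<zero>"
  shows "\<exists>k. y \<in> gr k"
proof -
  define S where "S = {i. comp i x \<noteq> \<zero>}"
  define T where "T = {i. comp i y \<noteq> \<zero>}"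
  have "x \<noteq> \<zero>" "y \<noteq> \<zero>"
    using x y xy(2) by auto
  then have ne: "S \<noteq> {}" "T \<noteq> {}"
    unfolding S_def T_def using nonzero_comp_ex x y by auto
  have fin: "finite S" "finite T"
    unfolding S_def T_def using finite_support x y by auto
  \<comment> \<open>If no other pair of occurring degrees has the sum \<open>p + q\<close>, then
    \<open>x \<otimes> y\<close> has a nonzero component in degree \<open>p + q\<close>; but it
    lives in degree \<open>n\<close> alone.\<close>
  have degree: "p + q = n"
    if "p \<in> S" "q \<in> T" "\<And>i j. i \<in> S \<Longrightarrow> j \<in> T \<Longrightarrow> i + j = p + q \<Longrightarrow> i = p" for p q
  proof (rule ccontr)
    assume "p + q \<noteq> n"
    then have "comp (p + q) (x \<otimes> y) = \<zero>"
      by (simp add: comp_gr[OF xy(1)])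
    moreover have "comp (p + q) (x \<otimes> y) = comp p x \<otimes> comp q y"
      by (rule comp_mult_extremal[OF x y]) (use that(3) in \<open>auto simp: S_def T_def\<close>)
    ultimately show False
      using dom that(1,2) comp_closed[OF x] comp_closed[OF y]
      unfolding noncomm_domain_def S_def T_def by auto
  qed
  have "Min S + Min T = n"
  proof (rule degree)
    fix i j
    assume "i \<in> S" "j \<in> T" "i + j = Min S + Min T"
    moreover from this have "Min S \<le> i" "Min T \<le> j"
      using fin by auto
    ultimately show "i = Min S"
      by linarith
  qed (use fin ne in auto)
  moreover have "Max S + Max T = n"
  proof (rule degree)
    fix i j
    assume "i \<in> S" "j \<in> T" "i + j = Max S + Max T"
    moreover from this have "i \<le> Max S" "j \<le> Max T"
      using fin by auto
    ultimately show "i = Max S"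
      by linarith
  qed (use fin ne in auto)
  moreover have "Min S \<le> Max S" "Min T \<le> Max T"
    using fin ne by auto
  \<comment> \<open>Equal sums of minima and of maxima leave no gap in either support, so
    \<open>T\<close> is a singleton.\<close>
  ultimately have "Min T = Max T"
    by linarith
  then have "\<And>i. i \<in> T \<Longrightarrow> i = Max T"
    using Min_le[OF fin(2)] Max_ge[OF fin(2)] by (metis antisym)
  then have "T = {Max T}"
    using Max_in[OF fin(2) ne(2)] by blast
  then have "y = (\<Oplus>i\<in>{Max T}. comp i y)"
    using sum_comp[OF y] T_def by simp
  then have "y = comp (Max T) y"
    using comp_closed[OF y] by simp
  then show ?thesis
    using comp_in_gr[OF y] by metis
qed

end


section \<open>Products of additive spans\<close>

lemma (in ring) generate_add_mult:
  assumes X: "S \<subseteq> carrier R" and Y: "T \<subseteq> carrier R"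
    and N: "subgroup N (add_monoid R)"
    and ST: "\<And>x y. x \<in> S \<Longrightarrow> y \<in> T \<Longrightarrow> x \<otimes> y \<in> N"
    and x: "x \<in> generate (add_monoid R) S" and y: "y \<in> generate (add_monoid R) T"
  shows "x \<otimes> y \<in> N"
proof -
  have N0: "\<zero> \<in> N" and Nadd: "\<And>u v. u \<in> N \<Longrightarrow> v \<in> N \<Longrightarrow> u \<oplus> v \<in> N"
    and Nneg: "\<And>u. u \<in> N \<Longrightarrow> \<ominus> u \<in> N"
    using subgroup.one_closed[OF N] subgroup.m_closed[OF N] subgroup.m_inv_closed[OF N]
    by (auto simp: a_inv_def)
  have Tc: "\<And>v. v \<in> generate (add_monoid R) T \<Longrightarrow> v \<in> carrier R"
    using add.generate_in_carrier[of T] Y by simp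
  have Sc: "\<And>v. v \<in> generate (add_monoid R) S \<Longrightarrow> v \<in> carrier R"
    using add.generate_in_carrier[of S] X by simp
  \<comment> \<open>One factor at a time: the left factor is a generator while the right one runs
    through its span; the left one is released afterwards.\<close>
  have *: "u \<otimes> y \<in> N" if u: "u \<in> S" for u
    using y
  proof (induction y rule: generate.induct)
    case one
    then show ?case
      using u X N0 by auto
  next
    case (incl v)
    then show ?case
      using u ST by simp
  next
    case (inv v)
    then have "u \<otimes> \<ominus> v \<in> N"
      using u X Y ST Nneg by (subst r_minus) auto
    then show ?case
      by (simp add: a_inv_def)
  next
    case (eng v w)
    then have "u \<otimes> (v \<oplus> w) \<in> N"
      using u X Tc Nadd by (subst r_distr) auto
    then show ?case
      by simp
  qed
  show ?thesis
    using x
  proof (induction x rule: generate.induct)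
    case one
    then show ?case
      using Tc[OF y] N0 by auto
  next
    case (incl v)
    then show ?case
      using * by simp
  next
    case (inv v)
    then have "\<ominus> v \<otimes> y \<in> N"
      using X Tc[OF y] * Nneg by (subst l_minus) auto
    then show ?case
      by (simp add: a_inv_def)
  next
    case (eng v w)
    then have "(v \<oplus> w) \<otimes> y \<in> N"
      using Sc Tc[OF y] Nadd by (subst l_distr) auto
    then show ?case
      by simp
  qed
qed


section \<open>Actions of the function algebra as group gradings\<close>

locale graded_fun_alg_action =
  fixes G :: "('g, 'x) monoid_scheme" and K :: "('k, 'y) ring_scheme"
    and A :: "('k, 'a, 'z) module_scheme" and gr :: "nat \<Rightarrow> 'a set"
    and act :: "('g \<Rightarrow> 'k) \<Rightarrow> 'a \<Rightarrow> 'a"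
  assumes group_G: "group G" and finite_G: "finite (carrier G)"
    and connected: "connected_graded K A gr"
    and generated: "generated_in_degree_one K A gr"
    and mod_alg: "module_algebra G K A act"
    and homogeneous: "acts_homogeneously G K gr act"
begin

sublocale graded_ring_components A gr
  using connected
  by (simp add: connected_graded_def graded_ring_components_def graded_ring_def
      graded_ring_components_axioms_def)

sublocale G: group G
  by (rule group_G)

sublocale K: field K
  using connected by (simp add: connected_graded_def)

sublocale M: module K A
  using connected by (simp add: connected_graded_def assoc_algebra_def)

lemma smult_mult:
  assumes "c \<in> carrier K" "x \<in> carrier A" "y \<in> carrier A"
  shows smult_mult_left: "(c \<odot>\<^bsub>A\<^esub> x) \<otimes>\<^bsub>A\<^esub> y = c \<odot>\<^bsub>A\<^esub> (x \<otimes>\<^bsub>A\<^esub> y)"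
    and smult_mult_right: "x \<otimes>\<^bsub>A\<^esub> (c \<odot>\<^bsub>A\<^esub> y) = c \<odot>\<^bsub>A\<^esub> (x \<otimes>\<^bsub>A\<^esub> y)"
  using connected assms unfolding connected_graded_def assoc_algebra_def by metis+

lemma gr_0: "gr 0 = scalars K A"
  using connected by (simp add: connected_graded_def)

abbreviation pt :: "'g \<Rightarrow> 'g \<Rightarrow> 'k" where
  "pt \<equiv> point_fun G K"

lemma pt_closed: "pt g \<in> carrier (fun_alg G K)"
  by (auto simp: fun_alg_def point_fun_def)

lemma pt_apply: "x \<in> carrier G \<Longrightarrow> pt g x = (if x = g then \<one>\<^bsub>K\<^esub> else \<zero>\<^bsub>K\<^esub>)"
  by (simp add: point_fun_def)

lemma fun_alg_apply_closed: "h \<in> carrier (fun_alg G K) \<Longrightarrow> g \<in> carrier G \<Longrightarrow> h g \<in> carrier K"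
  by (auto simp: fun_alg_def)

lemma
  assumes h: "h \<in> carrier (fun_alg G K)" and x: "x \<in> carrier A"
  shows act_closed: "act h x \<in> carrier A"
    and act_add: "y \<in> carrier A \<Longrightarrow> act h (x \<oplus>\<^bsub>A\<^esub> y) = act h x \<oplus>\<^bsub>A\<^esub> act h y"
    and act_smult: "c \<in> carrier K \<Longrightarrow> act h (c \<odot>\<^bsub>A\<^esub> x) = c \<odot>\<^bsub>A\<^esub> act h x"
    and add_act: "h' \<in> carrier (fun_alg G K) \<Longrightarrow>
        act (h \<oplus>\<^bsub>fun_alg G K\<^esub> h') x = act h x \<oplus>\<^bsub>A\<^esub> act h' x"
    and smult_act: "c \<in> carrier K \<Longrightarrow> act (c \<odot>\<^bsub>fun_alg G K\<^esub> h) x = c \<odot>\<^bsub>A\<^esub> act h x"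
    and mult_act: "h' \<in> carrier (fun_alg G K) \<Longrightarrow>
        act (h \<otimes>\<^bsub>fun_alg G K\<^esub> h') x = act h (act h' x)"
    and one_act: "act \<one>\<^bsub>fun_alg G K\<^esub> x = x"
    and act_mult: "y \<in> carrier A \<Longrightarrow> act h (x \<otimes>\<^bsub>A\<^esub> y) =
        (\<Oplus>\<^bsub>A\<^esub>s\<in>carrier G. \<Oplus>\<^bsub>A\<^esub>t\<in>carrier G.
          comult G h (s, t) \<odot>\<^bsub>A\<^esub> (act (pt s) x \<otimes>\<^bsub>A\<^esub> act (pt t) y))"
    and act_one: "act h \<one>\<^bsub>A\<^esub> = counit G h \<odot>\<^bsub>A\<^esub> \<one>\<^bsub>A\<^esub>"
proof -
  note * = mod_alg[unfolded module_algebra_def Let_def]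
  show "act h x \<in> carrier A"
    using * h x by meson
  show "act h (x \<oplus>\<^bsub>A\<^esub> y) = act h x \<oplus>\<^bsub>A\<^esub> act h y" if "y \<in> carrier A"
    using * h x that by meson
  show "act h (c \<odot>\<^bsub>A\<^esub> x) = c \<odot>\<^bsub>A\<^esub> act h x" if "c \<in> carrier K"
    using * h x that by meson
  show "act (h \<oplus>\<^bsub>fun_alg G K\<^esub> h') x = act h x \<oplus>\<^bsub>A\<^esub> act h' x" if "h' \<in> carrier (fun_alg G K)"
    using * h x that by meson
  show "act (c \<odot>\<^bsub>fun_alg G K\<^esub> h) x = c \<odot>\<^bsub>A\<^esub> act h x" if "c \<in> carrier K"
    using * h x that by meson
  show "act (h \<otimes>\<^bsub>fun_alg G K\<^esub> h') x = act h (act h' x)" if "h' \<in> carrier (fun_alg G K)"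
    using * h x that by meson
  show "act \<one>\<^bsub>fun_alg G K\<^esub> x = x"
    using * h x by meson
  show "act h (x \<otimes>\<^bsub>A\<^esub> y) =
        (\<Oplus>\<^bsub>A\<^esub>s\<in>carrier G. \<Oplus>\<^bsub>A\<^esub>t\<in>carrier G.
          comult G h (s, t) \<odot>\<^bsub>A\<^esub> (act (pt s) x \<otimes>\<^bsub>A\<^esub> act (pt t) y))" if "y \<in> carrier A"
    using * h x that by meson
  show "act h \<one>\<^bsub>A\<^esub> = counit G h \<odot>\<^bsub>A\<^esub> \<one>\<^bsub>A\<^esub>"
    using * h x by meson
qed

lemma act_gr: "h \<in> carrier (fun_alg G K) \<Longrightarrow> x \<in> gr i \<Longrightarrow> act h x \<in> gr i"
  using homogeneous by (auto simp: acts_homogeneously_def)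

lemma act_zero: "h \<in> carrier (fun_alg G K) \<Longrightarrow> act h \<zero>\<^bsub>A\<^esub> = \<zero>\<^bsub>A\<^esub>"
  using act_smult[of h "\<zero>\<^bsub>A\<^esub>" "\<zero>\<^bsub>K\<^esub>"] act_closed[of h "\<zero>\<^bsub>A\<^esub>"] by simp

lemma act_minus:
  assumes "h \<in> carrier (fun_alg G K)" "x \<in> carrier A"
  shows "act h (\<ominus>\<^bsub>A\<^esub> x) = \<ominus>\<^bsub>A\<^esub> act h x"
  using act_add[OF assms, of "\<ominus>\<^bsub>A\<^esub> x"] assms act_closed act_zero
  by (metis a_inv_closed add.inv_equality a_comm r_neg)

text \<open>In the function algebra, \<open>h\<close> times \<open>pt g\<close> is the scalar
  \<open>h g\<close> times \<open>pt g\<close>. Hence every element in the image of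
  \<open>act (pt g)\<close> is a joint eigenvector, its eigenvalues being given by evaluation at
  \<open>g\<close>.\<close>

lemma act_act_pt:
  assumes h: "h \<in> carrier (fun_alg G K)" and g: "g \<in> carrier G" and x: "x \<in> carrier A"
  shows "act h (act (pt g) x) = h g \<odot>\<^bsub>A\<^esub> act (pt g) x"
proof -
  have "h \<otimes>\<^bsub>fun_alg G K\<^esub> pt g = h g \<odot>\<^bsub>fun_alg G K\<^esub> pt g"
    using fun_alg_apply_closed[OF h] g
    by (auto simp: fun_alg_def point_fun_def fun_eq_iff restrict_def)
  then show ?thesis
    using mult_act[OF h x pt_closed] smult_act[OF pt_closed x fun_alg_apply_closed[OF h g]]
    by metis
qed

text \<open>The point functions sum to the unit of the function algebra, so an element killed by all
  of them is zero. The sum is built up through the indicator functions \<open>ind B\<close> of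
  finite subsets.\<close>

lemma act_pt_nonzero_ex:
  assumes x: "x \<in> carrier A" "x \<noteq> \<zero>\<^bsub>A\<^esub>"
  shows "\<exists>g\<in>carrier G. act (pt g) x \<noteq> \<zero>\<^bsub>A\<^esub>"
proof (rule ccontr)
  assume "\<not> ?thesis"
  then have zero: "\<And>g. g \<in> carrier G \<Longrightarrow> act (pt g) x = \<zero>\<^bsub>A\<^esub>"
    by blast
  define ind where "ind B = (\<lambda>y\<in>carrier G. if y \<in> B then \<one>\<^bsub>K\<^esub> else \<zero>\<^bsub>K\<^esub>)" for B
  have ind_closed: "ind B \<in> carrier (fun_alg G K)" for B
    by (auto simp: fun_alg_def ind_def)
  have "act (ind B) x = \<zero>\<^bsub>A\<^esub>" if "finite B" "B \<subseteq> carrier G" for B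
    using that
  proof (induction B rule: finite_induct)
    case empty
    \<comment> \<open>The zero function is written as zero times itself so that
      \<open>smult_act\<close> applies.\<close>
    have "ind {} = \<zero>\<^bsub>K\<^esub> \<odot>\<^bsub>fun_alg G K\<^esub> ind {}"
      by (auto simp: fun_alg_def ind_def fun_eq_iff restrict_def)
    then show ?case
      using smult_act[OF ind_closed x(1), of "\<zero>\<^bsub>K\<^esub>" "{}"] act_closed[OF ind_closed x(1)] by simp
  next
    case (insert g B)
    have "ind (insert g B) = pt g \<oplus>\<^bsub>fun_alg G K\<^esub> ind B"
      using insert.hyps by (auto simp: fun_alg_def ind_def point_fun_def fun_eq_iff restrict_def)
    then show ?case
      using insert add_act[OF pt_closed x(1) ind_closed] zero by simp
  qed
  moreover have "ind (carrier G) = \<one>\<^bsub>fun_alg G K\<^esub>"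
    by (auto simp: fun_alg_def ind_def fun_eq_iff restrict_def)
  ultimately show False
    using finite_G one_act[OF pt_closed x(1)] x(2) by (metis subset_refl)
qed

text \<open>The comultiplication of \<open>pt g\<close> is the indicator function of the pairs with
  product \<open>g\<close>. In terms of projections this is the rule that components of degrees
  \<open>s\<close> and \<open>t\<close> multiply into the component of degree
  \<open>s \<otimes> t\<close>.\<close>

lemma act_pt_mult:
  assumes g: "g \<in> carrier G" and x: "x \<in> carrier A" and y: "y \<in> carrier A"
  shows "act (pt g) (x \<otimes>\<^bsub>A\<^esub> y) = (\<Oplus>\<^bsub>A\<^esub>s\<in>carrier G. \<Oplus>\<^bsub>A\<^esub>t\<in>carrier G.
    if s \<otimes>\<^bsub>G\<^esub> t = g then act (pt s) x \<otimes>\<^bsub>A\<^esub> act (pt t) y else \<zero>\<^bsub>A\<^esub>)"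
proof -
  have "comult G (pt g) (s, t) \<odot>\<^bsub>A\<^esub> (act (pt s) x \<otimes>\<^bsub>A\<^esub> act (pt t) y)
      = (if s \<otimes>\<^bsub>G\<^esub> t = g then act (pt s) x \<otimes>\<^bsub>A\<^esub> act (pt t) y else \<zero>\<^bsub>A\<^esub>)"
    if "s \<in> carrier G" "t \<in> carrier G" for s t
    using that by (simp add: comult_def pt_apply act_closed[OF pt_closed] x y)
  then show ?thesis
    unfolding act_mult[OF pt_closed x y]
    by (intro finsum_cong' refl) (auto intro!: finsum_closed simp: act_closed[OF pt_closed] x y)
qed

section \<open>Monomials in elements of degree one\<close>

text \<open>Only the whole product has to lie in the component of \<open>g\<close>, not its single
  letters. The coefficient \<open>c\<close> is part of a monomial so that the additive subgroup
  generated by \<open>monomials g\<close> is already a subspace.\<close>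

definition monomials :: "'g \<Rightarrow> 'a set" where
  "monomials g = {m. act (pt g) m = m \<and>
     (\<exists>c xs. m = c \<odot>\<^bsub>A\<^esub> foldr (\<otimes>\<^bsub>A\<^esub>) xs \<one>\<^bsub>A\<^esub> \<and> c \<in> carrier K \<and> set xs \<subseteq> gr 1)}"

lemma word_gr: "set xs \<subseteq> gr 1 \<Longrightarrow> foldr (\<otimes>\<^bsub>A\<^esub>) xs \<one>\<^bsub>A\<^esub> \<in> gr (length xs)"
proof (induction xs)
  case Nil
  have "\<one>\<^bsub>A\<^esub> = \<one>\<^bsub>K\<^esub> \<odot>\<^bsub>A\<^esub> \<one>\<^bsub>A\<^esub>"
    by simp
  then have "\<one>\<^bsub>A\<^esub> \<in> gr 0"
    unfolding gr_0 scalars_def by (rule image_eqI) simp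
  then show ?case
    by simp
next
  case (Cons x xs)
  then show ?case
    using gr_mult[of x 1] by simp
qed

lemma word_closed: "set xs \<subseteq> gr 1 \<Longrightarrow> foldr (\<otimes>\<^bsub>A\<^esub>) xs \<one>\<^bsub>A\<^esub> \<in> carrier A"
  using word_gr gr_closed by blast

lemma word_append:
  assumes "set xs \<subseteq> gr 1" "set ys \<subseteq> gr 1"
  shows "foldr (\<otimes>\<^bsub>A\<^esub>) (xs @ ys) \<one>\<^bsub>A\<^esub> = foldr (\<otimes>\<^bsub>A\<^esub>) xs \<one>\<^bsub>A\<^esub> \<otimes>\<^bsub>A\<^esub> foldr (\<otimes>\<^bsub>A\<^esub>) ys \<one>\<^bsub>A\<^esub>"
  using assms
proof (induction xs)
  case (Cons x xs)
  then show ?case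
    using word_closed[of xs] word_closed[of ys] gr_closed[of x 1] by (simp add: m_assoc)
qed (simp add: word_closed)

text \<open>The pieces of the grading are only required to be additive subgroups. Closure under
  scalars comes from \<open>gr 0\<close> being the scalars, with multiplication by \<open>c\<close>
  read as multiplication by an element of degree zero.\<close>

lemma smult_gr:
  assumes c: "c \<in> carrier K" and x: "x \<in> gr n"
  shows "c \<odot>\<^bsub>A\<^esub> x \<in> gr n"
proof -
  have "(c \<odot>\<^bsub>A\<^esub> \<one>\<^bsub>A\<^esub>) \<otimes>\<^bsub>A\<^esub> x \<in> gr (0 + n)"
    by (rule gr_mult) (use c x in \<open>auto simp: gr_0 scalars_def\<close>)
  then show ?thesis
    using smult_mult_left[OF c one_closed gr_closed[OF x]] gr_closed[OF x] by simp
qed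

lemma monomials_gr: "m \<in> monomials g \<Longrightarrow> \<exists>n. m \<in> gr n"
  unfolding monomials_def by (blast intro: smult_gr word_gr)

lemma monomials_closed: "monomials g \<subseteq> carrier A"
  using monomials_gr gr_closed by blast

text \<open>Words are concatenated and coefficients multiplied. For the weight, the only summand of
  \<open>act_pt_mult\<close> that can survive is the one at the pair \<open>(s, t)\<close>.\<close>

lemma monomials_mult:
  assumes s: "s \<in> carrier G" and t: "t \<in> carrier G"
    and x: "x \<in> monomials s" and y: "y \<in> monomials t"
  shows "x \<otimes>\<^bsub>A\<^esub> y \<in> monomials (s \<otimes>\<^bsub>G\<^esub> t)"
proof -
  have c: "x \<in> carrier A" "y \<in> carrier A"
    using x y monomials_closed by auto
  \<comment> \<open>As \<open>x\<close> is fixed by \<open>act (pt s)\<close>, the other point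
    functions annihilate it.\<close>
  have px: "act (pt a) x = (if s = a then x else \<zero>\<^bsub>A\<^esub>)" if "a \<in> carrier G" for a
    using act_act_pt[OF pt_closed s c(1), of a] x s c by (auto simp: monomials_def pt_apply)
  have py: "act (pt a) y = (if t = a then y else \<zero>\<^bsub>A\<^esub>)" if "a \<in> carrier G" for a
    using act_act_pt[OF pt_closed t c(2), of a] y t c by (auto simp: monomials_def pt_apply)
  have "act (pt (s \<otimes>\<^bsub>G\<^esub> t)) (x \<otimes>\<^bsub>A\<^esub> y) = (\<Oplus>\<^bsub>A\<^esub>a\<in>carrier G. if s = a then
      (\<Oplus>\<^bsub>A\<^esub>b\<in>carrier G. if t = b then x \<otimes>\<^bsub>A\<^esub> y else \<zero>\<^bsub>A\<^esub>) else \<zero>\<^bsub>A\<^esub>)"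
    unfolding act_pt_mult[OF G.m_closed[OF s t] c]
  proof (intro finsum_cong' refl)
    fix a
    assume a: "a \<in> carrier G"
    have "(\<Oplus>\<^bsub>A\<^esub>b\<in>carrier G. if a \<otimes>\<^bsub>G\<^esub> b = s \<otimes>\<^bsub>G\<^esub> t
          then act (pt a) x \<otimes>\<^bsub>A\<^esub> act (pt b) y else \<zero>\<^bsub>A\<^esub>)
        = (\<Oplus>\<^bsub>A\<^esub>b\<in>carrier G. if s = a then (if t = b then x \<otimes>\<^bsub>A\<^esub> y else \<zero>\<^bsub>A\<^esub>) else \<zero>\<^bsub>A\<^esub>)"
      by (rule finsum_cong') (use a c in \<open>auto simp: px py\<close>)
    then show "(\<Oplus>\<^bsub>A\<^esub>b\<in>carrier G. if a \<otimes>\<^bsub>G\<^esub> b = s \<otimes>\<^bsub>G\<^esub> t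
          then act (pt a) x \<otimes>\<^bsub>A\<^esub> act (pt b) y else \<zero>\<^bsub>A\<^esub>)
        = (if s = a then (\<Oplus>\<^bsub>A\<^esub>b\<in>carrier G. if t = b then x \<otimes>\<^bsub>A\<^esub> y else \<zero>\<^bsub>A\<^esub>) else \<zero>\<^bsub>A\<^esub>)"
      by simp
  qed (use c in \<open>auto intro!: finsum_closed\<close>)
  also have "(\<Oplus>\<^bsub>A\<^esub>b\<in>carrier G. if t = b then x \<otimes>\<^bsub>A\<^esub> y else \<zero>\<^bsub>A\<^esub>) = x \<otimes>\<^bsub>A\<^esub> y"
    using t finite_G c by (subst add.finprod_singleton) auto
  also have "(\<Oplus>\<^bsub>A\<^esub>a\<in>carrier G. if s = a then x \<otimes>\<^bsub>A\<^esub> y else \<zero>\<^bsub>A\<^esub>) = x \<otimes>\<^bsub>A\<^esub> y"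
    using s finite_G c by (subst add.finprod_singleton) auto
  finally have weight: "act (pt (s \<otimes>\<^bsub>G\<^esub> t)) (x \<otimes>\<^bsub>A\<^esub> y) = x \<otimes>\<^bsub>A\<^esub> y" .
  obtain c xs where x': "x = c \<odot>\<^bsub>A\<^esub> foldr (\<otimes>\<^bsub>A\<^esub>) xs \<one>\<^bsub>A\<^esub>" "c \<in> carrier K" "set xs \<subseteq> gr 1"
    using x by (auto simp: monomials_def)
  obtain d ys where y': "y = d \<odot>\<^bsub>A\<^esub> foldr (\<otimes>\<^bsub>A\<^esub>) ys \<one>\<^bsub>A\<^esub>" "d \<in> carrier K" "set ys \<subseteq> gr 1"
    using y by (auto simp: monomials_def)
  have "x \<otimes>\<^bsub>A\<^esub> y = (c \<otimes>\<^bsub>K\<^esub> d) \<odot>\<^bsub>A\<^esub> foldr (\<otimes>\<^bsub>A\<^esub>) (xs @ ys) \<one>\<^bsub>A\<^esub>"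
    unfolding word_append[OF x'(3) y'(3)] using x' y' word_closed
    by (simp add: smult_mult_left smult_mult_right M.smult_assoc1[symmetric] K.m_comm)
  then show ?thesis
    unfolding monomials_def using weight x' y'
    by (intro CollectI conjI exI[of _ "c \<otimes>\<^bsub>K\<^esub> d"] exI[of _ "xs @ ys"]) auto
qed

text \<open>Induction on the generation of \<open>A\<close> by scalars and \<open>gr 1\<close>. The
  claim is proved for all \<open>g\<close> at once, because the projection of a product to
  \<open>g\<close> involves the projections of its factors to all \<open>s\<close> and
  \<open>t\<close> with product \<open>g\<close>.\<close>

lemma act_pt_in_span_monomials:
  assumes x: "x \<in> carrier A" and g: "g \<in> carrier G"
  shows "act (pt g) x \<in> generate (add_monoid A) (monomials g)"
proof -
  define S where "S g = generate (add_monoid A) (monomials g)" for g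
  have S: "subgroup (S g) (add_monoid A)" for g
    unfolding S_def using monomials_closed by (intro add.generate_is_subgroup) simp
  have S_closed: "u \<in> carrier A" if "u \<in> S g" for u g
    using subgroup.mem_carrier[OF S that] by simp
  note S_simps = subgroup.m_closed[OF S, simplified] subgroup.m_inv_closed[OF S, folded a_inv_def]
    subgroup.one_closed[OF S, simplified]
  have S_mult: "u \<otimes>\<^bsub>A\<^esub> v \<in> S (s \<otimes>\<^bsub>G\<^esub> t)"
    if "s \<in> carrier G" "t \<in> carrier G" "u \<in> S s" "v \<in> S t" for s t u v
  proof (rule generate_add_mult[OF monomials_closed monomials_closed S])
    show "x \<otimes>\<^bsub>A\<^esub> y \<in> S (s \<otimes>\<^bsub>G\<^esub> t)" if "x \<in> monomials s" "y \<in> monomials t" for x y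
      unfolding S_def by (rule generate.incl) (rule monomials_mult; fact)
  qed (use that in \<open>simp_all add: S_def\<close>)
  \<comment> \<open>By the counit rule, scalars are concentrated at the unit of the group, where
    they are monomials with the empty word.\<close>
  have scalar_act: "act (pt g) (c \<odot>\<^bsub>A\<^esub> \<one>\<^bsub>A\<^esub>) = c \<odot>\<^bsub>A\<^esub> (pt g \<one>\<^bsub>G\<^esub> \<odot>\<^bsub>A\<^esub> \<one>\<^bsub>A\<^esub>)"
    if "c \<in> carrier K" for c g
    unfolding act_smult[OF pt_closed one_closed that] act_one[OF pt_closed one_closed] counit_def ..
  have scalar: "act (pt g) (c \<odot>\<^bsub>A\<^esub> \<one>\<^bsub>A\<^esub>) \<in> S g" if c: "c \<in> carrier K" and g: "g \<in> carrier G" for c g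
  proof (cases "g = \<one>\<^bsub>G\<^esub>")
    case True
    then have "act (pt g) (c \<odot>\<^bsub>A\<^esub> \<one>\<^bsub>A\<^esub>) = c \<odot>\<^bsub>A\<^esub> \<one>\<^bsub>A\<^esub>"
      using scalar_act[OF c, of g] c by (simp add: pt_apply)
    moreover from this have "c \<odot>\<^bsub>A\<^esub> \<one>\<^bsub>A\<^esub> \<in> monomials g"
      unfolding monomials_def using c by (intro CollectI conjI exI[of _ c] exI[of _ "[]"]) auto
    ultimately show ?thesis
      by (simp add: S_def generate.incl)
  next
    case False
    then have "act (pt g) (c \<odot>\<^bsub>A\<^esub> \<one>\<^bsub>A\<^esub>) = \<zero>\<^bsub>A\<^esub>"
      using scalar_act[OF c, of g] c by (simp add: pt_apply)
    then show ?thesis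
      by (simp add: S_simps)
  qed
  \<comment> \<open>Since the action preserves \<open>gr 1\<close>, each projection of
    \<open>v\<close> is again of degree one and thus a word with a single letter.\<close>
  have degree_one: "act (pt g) v \<in> S g" if v: "v \<in> gr 1" and g: "g \<in> carrier G" for v g
  proof -
    have vc: "v \<in> carrier A"
      using v gr_closed by blast
    have "act (pt g) (act (pt g) v) = act (pt g) v"
      using act_act_pt[OF pt_closed g vc, of g] g by (simp add: pt_apply act_closed[OF pt_closed vc])
    moreover have "act (pt g) v = \<one>\<^bsub>K\<^esub> \<odot>\<^bsub>A\<^esub> foldr (\<otimes>\<^bsub>A\<^esub>) [act (pt g) v] \<one>\<^bsub>A\<^esub>"
      by (simp add: act_closed[OF pt_closed vc])
    ultimately have "act (pt g) v \<in> monomials g"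
      unfolding monomials_def using act_gr[OF pt_closed v]
      by (intro CollectI conjI exI[of _ "\<one>\<^bsub>K\<^esub>"] exI[of _ "[act (pt g) v]"]) auto
    then show ?thesis
      by (simp add: S_def generate.incl)
  qed
  have gen: "carrier A = generate_ring A (scalars K A \<union> gr 1)"
    using generated by (simp add: generated_in_degree_one_def)
  have "\<forall>g\<in>carrier G. act (pt g) x \<in> S g"
    using x unfolding gen
  proof (induction x rule: generate_ring.induct)
    case one
    then show ?case
      using scalar[of "\<one>\<^bsub>K\<^esub>"] by simp
  next
    case (incl h)
    then show ?case
      using scalar degree_one by (auto simp: scalars_def)
  next
    case (a_inv h)
    then show ?case
      using S_simps a_inv.hyps[folded gen] by (simp add: act_minus[OF pt_closed])
  next
    case (eng_add h1 h2)
    then show ?case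
      using S_simps eng_add.hyps[folded gen] by (simp add: act_add[OF pt_closed])
  next
    case (eng_mult h1 h2)
    note c = eng_mult.hyps[folded gen]
    have sum: "(\<Oplus>\<^bsub>A\<^esub>a\<in>B. f a) \<in> S g" if "finite B" "\<And>a. a \<in> B \<Longrightarrow> f a \<in> S g" for B f g
      using that
    proof (induction B rule: finite_induct)
      case (insert a B)
      have f: "f b \<in> S g" if "b \<in> insert a B" for b
        by (rule insert.prems[OF that])
      have "(\<Oplus>\<^bsub>A\<^esub>b\<in>insert a B. f b) = f a \<oplus>\<^bsub>A\<^esub> (\<Oplus>\<^bsub>A\<^esub>b\<in>B. f b)"
        using insert.hyps f S_closed by (intro finsum_insert) auto
      moreover have "\<dots> \<in> S g"
        using f insert.IH by (intro S_simps(1)) auto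
      ultimately show ?case
        by simp
    qed (simp add: S_simps)
    show ?case
    proof
      fix g
      assume g: "g \<in> carrier G"
      have "(if s \<otimes>\<^bsub>G\<^esub> t = g then act (pt s) h1 \<otimes>\<^bsub>A\<^esub> act (pt t) h2 else \<zero>\<^bsub>A\<^esub>) \<in> S g"
        if "s \<in> carrier G" "t \<in> carrier G" for s t
        using that eng_mult.IH S_mult[OF that] S_simps(3) by (cases "s \<otimes>\<^bsub>G\<^esub> t = g") auto
      then show "act (pt g) (h1 \<otimes>\<^bsub>A\<^esub> h2) \<in> S g"
        unfolding act_pt_mult[OF g c] by (intro sum finite_G)
    qed
  qed
  then show ?thesis
    using g by (simp add: S_def)
qed

section \<open>Weight spaces and their generators\<close>

text \<open>A nonzero weight vector \<open>f\<close> forces \<open>\<chi>\<close> to be evaluation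
  at a group element: choose \<open>g\<close> with \<open>act (pt g) f\<close> nonzero and apply
  \<open>h\<close> to this multiple of \<open>f\<close> in two ways. Cancelling the unit
  \<open>\<chi> (pt g)\<close> and then \<open>f\<close> gives
  \<open>\<chi> h = h g\<close>.\<close>

lemma weight_space_eq_component:
  assumes f: "f \<in> weight_space G K A act \<chi>" "f \<noteq> \<zero>\<^bsub>A\<^esub>"
    and \<chi>: "\<And>h. h \<in> carrier (fun_alg G K) \<Longrightarrow> \<chi> h \<in> carrier K"
  shows "\<exists>g\<in>carrier G. weight_space G K A act \<chi> = {x \<in> carrier A. act (pt g) x = x}"
proof -
  have fc: "f \<in> carrier A" and act_f: "\<And>h. h \<in> carrier (fun_alg G K) \<Longrightarrow> act h f = \<chi> h \<odot>\<^bsub>A\<^esub> f"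
    using f(1) by (auto simp: weight_space_def)
  have cancel: "c = d" if "c \<in> carrier K" "d \<in> carrier K" "c \<odot>\<^bsub>A\<^esub> f = d \<odot>\<^bsub>A\<^esub> f" for c d
  proof (rule ccontr)
    assume "c \<noteq> d"
    then have u: "c \<ominus>\<^bsub>K\<^esub> d \<in> Units K"
      using that K.field_Units by auto
    have "(c \<ominus>\<^bsub>K\<^esub> d) \<odot>\<^bsub>A\<^esub> f = \<zero>\<^bsub>A\<^esub>"
      using that fc by (simp add: a_minus_def M.smult_l_distr M.smult_l_minus r_neg)
    then have "inv\<^bsub>K\<^esub> (c \<ominus>\<^bsub>K\<^esub> d) \<odot>\<^bsub>A\<^esub> ((c \<ominus>\<^bsub>K\<^esub> d) \<odot>\<^bsub>A\<^esub> f) = \<zero>\<^bsub>A\<^esub>"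
      using u by simp
    then show False
      using u fc f(2) by (subst (asm) M.smult_assoc1[symmetric]) auto
  qed
  obtain g where g: "g \<in> carrier G" "act (pt g) f \<noteq> \<zero>\<^bsub>A\<^esub>"
    using act_pt_nonzero_ex[OF fc f(2)] by blast
  have \<chi>_eq: "\<chi> h = h g" if h: "h \<in> carrier (fun_alg G K)" for h
  proof -
    have "\<chi> (pt g) \<odot>\<^bsub>A\<^esub> (\<chi> h \<odot>\<^bsub>A\<^esub> f) = \<chi> (pt g) \<odot>\<^bsub>A\<^esub> (h g \<odot>\<^bsub>A\<^esub> f)"
      using act_act_pt[OF h g(1) fc] act_f[OF pt_closed] act_f[OF h] act_smult[OF h fc] \<chi> h pt_closed fc
        fun_alg_apply_closed[OF h g(1)]
      by (metis K.m_comm M.smult_assoc1)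
    moreover have "\<chi> (pt g) \<in> Units K"
      using g(2) act_f[OF pt_closed] \<chi>[OF pt_closed] fc by (auto simp: K.field_Units)
    ultimately have "\<chi> h \<odot>\<^bsub>A\<^esub> f = h g \<odot>\<^bsub>A\<^esub> f"
      using \<chi>[OF h] fun_alg_apply_closed[OF h g(1)] fc
      by (metis K.Units_closed K.Units_inv_closed K.Units_l_inv M.smult_assoc1 M.smult_closed M.smult_one)
    then show ?thesis
      using cancel \<chi>[OF h] fun_alg_apply_closed[OF h g(1)] by blast
  qed
  have "weight_space G K A act \<chi> = {x \<in> carrier A. act (pt g) x = x}"
  proof (intro equalityI subsetI)
    fix x
    assume "x \<in> weight_space G K A act \<chi>"
    then have "x \<in> carrier A" "act (pt g) x = pt g g \<odot>\<^bsub>A\<^esub> x"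
      using \<chi>_eq[OF pt_closed] pt_closed[of g] by (auto simp: weight_space_def)
    then show "x \<in> {x \<in> carrier A. act (pt g) x = x}"
      using g(1) by (simp add: pt_apply)
  next
    fix x
    assume "x \<in> {x \<in> carrier A. act (pt g) x = x}"
    then show "x \<in> weight_space G K A act \<chi>"
      using act_act_pt[OF _ g(1), of _ x] \<chi>_eq by (auto simp: weight_space_def)
  qed
  then show ?thesis
    using g(1) by blast
qed

text \<open>Among the monomials spanning the component that contains \<open>f\<close>, one is a
  nonzero scalar multiple of \<open>f\<close>. The case of the Jacobian takes the inverse of the
  homological determinant for \<open>\<chi>\<close>, that of the reflection arrangement the
  homological determinant itself.\<close>

lemma generator_product_of_degree_one:
  assumes dom: "noncomm_domain A" and gen: "generates_weight_space G K A act \<chi> f"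
    and \<chi>: "\<And>h. h \<in> carrier (fun_alg G K) \<Longrightarrow> \<chi> h \<in> carrier K"
  shows "product_of_degree_one K A gr f"
proof (cases "f = \<zero>\<^bsub>A\<^esub>")
  case True
  \<comment> \<open>Degenerate case: \<open>0\<close> itself lies in degree one.\<close>
  then have "f = \<one>\<^bsub>K\<^esub> \<odot>\<^bsub>A\<^esub> foldr (\<otimes>\<^bsub>A\<^esub>) [\<zero>\<^bsub>A\<^esub>] \<one>\<^bsub>A\<^esub>"
    by simp
  then show ?thesis
    unfolding product_of_degree_one_def using gr_zero
    by (intro exI[of _ "\<one>\<^bsub>K\<^esub>"] exI[of _ "[\<zero>\<^bsub>A\<^esub>]"]) auto
next
  case False
  have fc: "f \<in> carrier A"
    and W: "weight_space G K A act \<chi> = (\<lambda>r. f \<otimes>\<^bsub>A\<^esub> r) ` invariants G K A act"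
    using gen by (auto simp: generates_weight_space_def)
  have "\<one>\<^bsub>A\<^esub> \<in> invariants G K A act"
    using act_one[OF _ one_closed] by (simp add: invariants_def weight_space_def)
  then have "f \<otimes>\<^bsub>A\<^esub> \<one>\<^bsub>A\<^esub> \<in> weight_space G K A act \<chi>"
    unfolding W by (rule imageI)
  then have fW: "f \<in> weight_space G K A act \<chi>"
    using fc by simp
  have "\<exists>g\<in>carrier G. weight_space G K A act \<chi> = {x \<in> carrier A. act (pt g) x = x}"
    by (rule weight_space_eq_component[OF fW False]) (rule \<chi>)
  then obtain g where g: "g \<in> carrier G"
    and W_eq: "weight_space G K A act \<chi> = {x \<in> carrier A. act (pt g) x = x}"
    by blast
  have factor: "\<exists>r\<in>carrier A. m = f \<otimes>\<^bsub>A\<^esub> r" if "m \<in> monomials g" for m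
  proof -
    have "m \<in> weight_space G K A act \<chi>"
      using that monomials_closed unfolding W_eq monomials_def by blast
    then show ?thesis
      unfolding W by (auto simp: invariants_def weight_space_def)
  qed
  have "\<exists>m\<in>monomials g. \<exists>r\<in>carrier A. m = f \<otimes>\<^bsub>A\<^esub> r \<and> comp 0 r \<noteq> \<zero>\<^bsub>A\<^esub>"
  proof (rule ccontr)
    assume neg: "\<not> ?thesis"
    \<comment> \<open>\<open>N\<close> collects the multiples of \<open>f\<close> by elements
      without constant term. It is an additive subgroup, so it contains \<open>f\<close> once it
      contains all monomials of weight \<open>g\<close>.\<close>
    define N where "N = (\<lambda>r. f \<otimes>\<^bsub>A\<^esub> r) ` {r \<in> carrier A. comp 0 r = \<zero>\<^bsub>A\<^esub>}"
    have comp_minus: "comp 0 (\<ominus>\<^bsub>A\<^esub> r) = \<zero>\<^bsub>A\<^esub>" if "r \<in> carrier A" "comp 0 r = \<zero>\<^bsub>A\<^esub>" for r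
      using that comp_add[of r "\<ominus>\<^bsub>A\<^esub> r" 0] comp_closed[of "\<ominus>\<^bsub>A\<^esub> r" 0] by (simp add: comp_zero r_neg)
    have "subgroup N (add_monoid A)"
    proof (rule add.subgroupI)
      show "N \<noteq> {}"
        using comp_zero by (auto simp: N_def)
      show "\<ominus>\<^bsub>A\<^esub> a \<in> N" if "a \<in> N" for a
        using that fc comp_minus by (auto simp: N_def r_minus[symmetric])
      show "a \<oplus>\<^bsub>A\<^esub> b \<in> N" if "a \<in> N" "b \<in> N" for a b
        using that fc by (auto simp: N_def r_distr[symmetric] comp_add)
    qed (use fc in \<open>auto simp: N_def\<close>)
    moreover have "monomials g \<subseteq> N"
      using neg factor by (fastforce simp: N_def)
    ultimately have "generate (add_monoid A) (monomials g) \<subseteq> N"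
      by (rule add.generate_subgroup_incl[rotated])
    moreover have "f \<in> generate (add_monoid A) (monomials g)"
      using act_pt_in_span_monomials[OF fc g] fW unfolding W_eq by simp
    ultimately obtain r where r: "r \<in> carrier A" "comp 0 r = \<zero>\<^bsub>A\<^esub>" "f = f \<otimes>\<^bsub>A\<^esub> r"
      by (auto simp: N_def)
    \<comment> \<open>Cancelling \<open>f\<close> in the domain leaves \<open>r = \<one>\<close>,
      whose constant term is not zero.\<close>
    have "f \<otimes>\<^bsub>A\<^esub> (r \<ominus>\<^bsub>A\<^esub> \<one>\<^bsub>A\<^esub>) = \<zero>\<^bsub>A\<^esub>"
      using r(1) r(3)[symmetric] fc by (simp add: a_minus_def r_distr r_minus r_neg)
    then have "r \<ominus>\<^bsub>A\<^esub> \<one>\<^bsub>A\<^esub> = \<zero>\<^bsub>A\<^esub>"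
      using dom False fc r(1) unfolding noncomm_domain_def by (meson minus_closed one_closed)
    then have "r = \<one>\<^bsub>A\<^esub>"
      using r(1) by simp
    moreover have "comp 0 \<one>\<^bsub>A\<^esub> = \<one>\<^bsub>A\<^esub>"
      using comp_gr[OF word_gr[of "[]"]] by simp
    ultimately show False
      using r(2) dom by (simp add: noncomm_domain_def)
  qed
  then obtain m r where m: "m \<in> monomials g" and r: "r \<in> carrier A" "m = f \<otimes>\<^bsub>A\<^esub> r" "comp 0 r \<noteq> \<zero>\<^bsub>A\<^esub>"
    by blast
  have r0: "r \<noteq> \<zero>\<^bsub>A\<^esub>"
    using r(3) comp_zero by auto
  have m0: "m \<noteq> \<zero>\<^bsub>A\<^esub>"
    using r r0 False fc dom by (auto simp: noncomm_domain_def)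
  \<comment> \<open>The monomial \<open>m\<close> is homogeneous in the degree grading, hence so is
    its right factor \<open>r\<close>; the nonzero constant term then puts \<open>r\<close> into
    degree zero, among the scalars.\<close>
  obtain k where "r \<in> gr k"
    using monomials_gr[OF m] right_factor_homogeneous[OF dom fc r(1)] r(2) m0 by auto
  then have "r \<in> gr 0"
    using r(3) by (auto simp: comp_gr split: if_splits)
  then obtain d where d: "d \<in> carrier K" "r = d \<odot>\<^bsub>A\<^esub> \<one>\<^bsub>A\<^esub>"
    by (auto simp: gr_0 scalars_def)
  have dU: "d \<in> Units K"
    using d r0 by (auto simp: K.field_Units)
  obtain c xs where c: "m = c \<odot>\<^bsub>A\<^esub> foldr (\<otimes>\<^bsub>A\<^esub>) xs \<one>\<^bsub>A\<^esub>" "c \<in> carrier K" "set xs \<subseteq> gr 1"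
    using m by (auto simp: monomials_def)
  have "c \<noteq> \<zero>\<^bsub>K\<^esub>"
    using m0 c word_closed by auto
  then have nonzero: "inv\<^bsub>K\<^esub> d \<otimes>\<^bsub>K\<^esub> c \<noteq> \<zero>\<^bsub>K\<^esub>"
    using c(2) dU K.Units_inv_Units[OF dU] by (auto simp: K.field_Units K.integral_iff)
  have "d \<odot>\<^bsub>A\<^esub> f = m"
    using d fc r(2) by (simp add: smult_mult_right)
  then have "f = inv\<^bsub>K\<^esub> d \<odot>\<^bsub>A\<^esub> m"
    using dU d fc by (metis K.Units_inv_closed K.Units_l_inv M.smult_assoc1 M.smult_one)
  also have "\<dots> = (inv\<^bsub>K\<^esub> d \<otimes>\<^bsub>K\<^esub> c) \<odot>\<^bsub>A\<^esub> foldr (\<otimes>\<^bsub>A\<^esub>) xs \<one>\<^bsub>A\<^esub>"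
    using c dU word_closed by (simp add: M.smult_assoc1)
  finally show ?thesis
    unfolding product_of_degree_one_def using nonzero c dU
    by (intro exI[of _ "inv\<^bsub>K\<^esub> d \<otimes>\<^bsub>K\<^esub> c"] exI[of _ xs]) auto
qed

end

section \<open>Values of the homological determinant\<close>

lemma (in group) antipode_closed:
  "h \<in> carrier (fun_alg G K) \<Longrightarrow> antipode G h \<in> carrier (fun_alg G K)"
  by (auto simp: antipode_def fun_alg_def)

lemma (in group) character_inv_closed:
  assumes "\<chi> \<in> alg_characters G K" "h \<in> carrier (fun_alg G K)"
  shows "character_inv G K \<chi> h \<in> carrier K"
  using assms antipode_closed[of h K]
  by (auto simp: character_inv_def alg_characters_def ring_hom_def)

text \<open>By definition \<open>\<chi>\<close> is \<open>character_inv\<close> of the algebra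
  character by which the function algebra acts on the lowest part of the dual.\<close>

lemma is_hdet_closed:
  assumes "group G" "is_hdet U G K A gr act \<chi>" "h \<in> carrier (fun_alg G K)"
  shows "\<chi> h \<in> carrier K"
proof -
  obtain \<eta> where "\<eta> \<in> alg_characters G K" "\<chi> = character_inv G K \<eta>"
    using assms(2) unfolding is_hdet_def Let_def by blast
  then show ?thesis
    using group.character_inv_closed[OF assms(1)] assms(3) by blast
qed

theorem theorem0p5:
  fixes K :: "'k ring"
    and G :: "'g monoid"
    and A :: "('k, 'a) module"
    and gr :: "nat \<Rightarrow> 'a set"
    and act :: "('g \<Rightarrow> 'k) \<Rightarrow> 'a \<Rightarrow> 'a"
    and j a :: 'a
  assumes universe: "\<exists>\<iota> :: 'a \<Rightarrow> 'u. inj_on \<iota> (carrier A)"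
    and "algebraically_closed K" and "char_zero K"
    and "group G" and "finite (carrier G)"
    and "noetherian A"
    and "as_regular TYPE('u) K A gr"
    and "noncomm_domain A"
    and "generated_in_degree_one K A gr"
    and "module_algebra G K A act"
    and "acts_homogeneously G K gr act"
    and "inner_faithful G K A act"
    and "as_regular TYPE('u) K (invariant_ring G K A act) (invariant_grading G K A gr act)"
    and "is_jacobian TYPE('u) G K A gr act j"
    and "is_reflection_arrangement TYPE('u) G K A gr act a"
  shows "product_of_degree_one K A gr j \<and> product_of_degree_one K A gr a"
proof -
  interpret graded_fun_alg_action G K A gr act
    using assms(4,5,7,9,10,11)
    by (simp add: graded_fun_alg_action_def as_regular_def as_gorenstein_def)
  obtain \<chi> where \<chi>: "is_hdet TYPE('u) G K A gr act \<chi>"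
    "generates_weight_space G K A act (character_inv G K \<chi>) j"
    using assms(14) unfolding is_jacobian_def by blast
  \<comment> \<open>The inverse character at \<open>h\<close> is \<open>\<chi>\<close> at the
    antipode of \<open>h\<close>, where \<open>is_hdet_closed\<close> applies.\<close>
  have "character_inv G K \<chi> h \<in> carrier K" if "h \<in> carrier (fun_alg G K)" for h
    using is_hdet_closed[OF group_G \<chi>(1) G.antipode_closed[OF that]] that by (simp add: character_inv_def)
  then have "product_of_degree_one K A gr j"
    by (rule generator_product_of_degree_one[OF assms(8) \<chi>(2)])
  \<comment> \<open>\<open>is_hdet\<close> is a relation, and the reflection arrangement supplies
    its own witness \<open>\<psi>\<close>.\<close>
  moreover obtain \<psi> where \<psi>: "is_hdet TYPE('u) G K A gr act \<psi>" "generates_weight_space G K A act \<psi> a"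
    using assms(15) unfolding is_reflection_arrangement_def by blast
  have "product_of_degree_one K A gr a"
    by (rule generator_product_of_degree_one[OF assms(8) \<psi>(2)])
      (rule is_hdet_closed[OF group_G \<psi>(1)])
  ultimately show ?thesis ..
qed

end
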